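(* Let $X$ be a locale whose frame is given by a $\mathbf{PreFrm}$-type presentation $\mathcal{O}X = \langle G \text{ } \vee\text{-semilattice} \mid R\rangle_{\mathbf{Frm}}$, and let $q\colon X \twoheadrightarrow Y$ be a semi-proper quotient. Then $$\mathcal{O}Y \cong \langle \Box g,\ g \in G \mid R,\ \Box 0 = 0,\ \Box s \vee \Box t = \Box(q^*q_*(s) \vee q^*q_*(t)),\ s,t \in G\rangle_{\mathbf{Frm}},$$ where the generators $\Box g$ are indexed by the underlying set of $G$; $\Box(q^*q_*(s)\vee q^*q_*(t))$ is interpreted as $\bigvee^{\uparrow}_{\alpha,\beta}\bigwedge_{i_\alpha,j_\beta} \Box(s_\alpha^{i_\alpha} \vee t_\beta^{j_\beta})$ for specified representations $q^*q_*(s) = \bigvee^{\uparrow}_{\alpha}\bigwedge_{i_\alpha} s_\alpha^{i_\alpha}$ and $q^*q_*(t) = \bigvee^{\uparrow}_{\beta}\bigwedge_{j_\beta} t_\beta^{j_\beta}$ in $\mathcal{O}X$ as directed joins of finite meets of generators from $G$ (with $s_\alpha^{i_\alpha} \vee t_\beta^{j_\beta}$ computed in $G$); and each relation of $R$ is read with every generator $g$ replaced by $\Box g$.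
   Context: For a locale $X$, $\mathcal{O}X$ denotes its frame; a locale map $f\colon X\to Y$ corresponds to a frame homomorphism $f^*\colon\mathcal{O}Y\to\mathcal{O}X$ with right adjoint $f_*\colon\mathcal{O}X\to\mathcal{O}Y$. $f$ is semi-proper if $f_*$ preserves directed joins; a semi-proper quotient is an epic (i.e. $f^*$ injective) semi-proper map. $\bigvee^{\uparrow}$ denotes a join of a directed family. $\langle G\mid R\rangle_{\mathbf{Frm}}$ denotes the frame presented by generators $G$ and relations $R$ (formal equalities and inequalities between elements of the free frame on $G$); "$G$ $\vee$-semilattice" means the free frame on the $\vee$-semilattice $G$ is used (equivalently, relations are added forcing finite joins, including the bottom $0$, to agree with those in $G$). Semilattices are unital. A presentation $\langle G \text{ }\vee\text{-semilattice}\mid R\rangle_{\mathbf{Frm}}$ is $\mathbf{PreFrm}$-type if every relation in $R$ has the form $\bigvee^{\uparrow}_\alpha\bigwedge A_\alpha \le \bigvee^{\uparrow}_\beta\bigwedge B_\beta$ with each $A_\alpha, B_\beta\subseteq G$ finite, and whenever this is in $R$, so is $\bigvee^{\uparrow}_\alpha\bigwedge_{a\in A_\alpha}(a\vee c) \le \bigvee^{\uparrow}_\beta\bigwedge_{b\in B_\beta}(b\vee c)$ for each $c\in G$.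
   Formalization: False for arbitrary specified representations (e.g. G={0<s<t}, R empty, q=id, t given as the join of 0 and t). Proved instead: for all representations, with the added relations □s ≤ □t for s ≤ t in G; and without these added relations, for some choice of representations. *)

theory Defs
  imports Main
begin

section \<open>Frames and semi-proper quotients\<close>

class frame = complete_lattice +
  assumes inf_Sup_frame: "inf x (Sup A) = Sup (inf x ` A)"

definition directed_wrt :: "('a \<Rightarrow> 'a \<Rightarrow> bool) \<Rightarrow> 'a set \<Rightarrow> bool" where
  "directed_wrt le D \<longleftrightarrow> D \<noteq> {} \<and> (\<forall>x\<in>D. \<forall>y\<in>D. \<exists>z\<in>D. le x z \<and> le y z)"

definition frame_hom :: "('b::frame \<Rightarrow> 'a::frame) \<Rightarrow> bool" where
  "frame_hom f \<longleftrightarrow>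
     (\<forall>A. f (Sup A) = Sup (f ` A)) \<and> f top = top \<and> (\<forall>x y. f (inf x y) = inf (f x) (f y))"

definition right_adjoint :: "('b::order \<Rightarrow> 'a::order) \<Rightarrow> ('a \<Rightarrow> 'b) \<Rightarrow> bool" where
  "right_adjoint f g \<longleftrightarrow> (\<forall>x y. f x \<le> y \<longleftrightarrow> x \<le> g y)"

text \<open>A locale map \<open>X \<rightarrow> Y\<close> is given by its inverse image \<open>qu :: OY \<Rightarrow> OX\<close>; \<open>ql\<close> is the
  direct image \<open>OX \<Rightarrow> OY\<close>, which \<open>qu\<close> determines.\<close>

definition semi_proper_quotient :: "('b::frame \<Rightarrow> 'a::frame) \<Rightarrow> ('a \<Rightarrow> 'b) \<Rightarrow> bool" where
  "semi_proper_quotient qu ql \<longleftrightarrow>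
     frame_hom qu \<and> right_adjoint qu ql \<and> inj qu \<and>
     (\<forall>D. directed_wrt (\<le>) D \<longrightarrow> ql (Sup D) = Sup (ql ` D))"

section \<open>The free frame on a set\<close>

text \<open>The family \<open>U\<close> stands for the formal join of the formal meets of its members, so
  \<open>U\<close> is upward closed among the finite subsets of the generating set.\<close>

typedef 'g free_frame =
  "{U :: 'g set set. (\<forall>A\<in>U. finite A) \<and> (\<forall>A\<in>U. \<forall>B. finite B \<longrightarrow> A \<subseteq> B \<longrightarrow> B \<in> U)}"
  by (rule exI[of _ "{}"]) simp

setup_lifting type_definition_free_frame

instantiation free_frame :: (type) frame
begin

lift_definition less_eq_free_frame :: "'a free_frame \<Rightarrow> 'a free_frame \<Rightarrow> bool" is "(\<subseteq>)" .
lift_definition less_free_frame :: "'a free_frame \<Rightarrow> 'a free_frame \<Rightarrow> bool" is "(\<subset>)" .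
lift_definition inf_free_frame :: "'a free_frame \<Rightarrow> 'a free_frame \<Rightarrow> 'a free_frame" is "(\<inter>)"
  by blast
lift_definition sup_free_frame :: "'a free_frame \<Rightarrow> 'a free_frame \<Rightarrow> 'a free_frame" is "(\<union>)"
  by blast
lift_definition Sup_free_frame :: "'a free_frame set \<Rightarrow> 'a free_frame" is "\<Union>"
  by blast
lift_definition Inf_free_frame :: "'a free_frame set \<Rightarrow> 'a free_frame" is
  "\<lambda>\<U>. {A. finite A \<and> (\<forall>U\<in>\<U>. A \<in> U)}"
  by blast
lift_definition bot_free_frame :: "'a free_frame" is "{}"
  by simp
lift_definition top_free_frame :: "'a free_frame" is "{A. finite A}"
  by simp

instance
proof
  fix x y z :: "'a free_frame" and A :: "'a free_frame set"
  note rep = less_eq_free_frame.rep_eq less_free_frame.rep_eq inf_free_frame.rep_eq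
    sup_free_frame.rep_eq Sup_free_frame.rep_eq Inf_free_frame.rep_eq
    bot_free_frame.rep_eq top_free_frame.rep_eq
  have fin: "finite B" if "B \<in> Rep_free_frame w" for B and w :: "'a free_frame"
    using that Rep_free_frame[of w] by simp
  show "(x < y) = (x \<le> y \<and> \<not> y \<le> x)" unfolding rep by blast
  show "x \<le> x" unfolding rep by blast
  show "x \<le> y \<Longrightarrow> y \<le> z \<Longrightarrow> x \<le> z" unfolding rep by blast
  show "x \<le> y \<Longrightarrow> y \<le> x \<Longrightarrow> x = y"
    unfolding rep Rep_free_frame_inject[symmetric] by blast
  show "inf x y \<le> x" "inf x y \<le> y" unfolding rep by blast+
  show "x \<le> y \<Longrightarrow> x \<le> z \<Longrightarrow> x \<le> inf y z" unfolding rep by blast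
  show "x \<le> sup x y" "y \<le> sup x y" unfolding rep by blast+
  show "y \<le> x \<Longrightarrow> z \<le> x \<Longrightarrow> sup y z \<le> x" unfolding rep by blast
  show "x \<in> A \<Longrightarrow> Inf A \<le> x" unfolding rep by auto
  show "(\<And>x. x \<in> A \<Longrightarrow> z \<le> x) \<Longrightarrow> z \<le> Inf A" unfolding rep using fin by auto
  show "x \<in> A \<Longrightarrow> x \<le> Sup A" unfolding rep by auto
  show "(\<And>x. x \<in> A \<Longrightarrow> x \<le> z) \<Longrightarrow> Sup A \<le> z" unfolding rep by auto
  show "Inf {} = (top :: 'a free_frame)" unfolding rep Rep_free_frame_inject[symmetric] by simp
  show "Sup {} = (bot :: 'a free_frame)" unfolding rep Rep_free_frame_inject[symmetric] by simp
  show "inf x (Sup A) = Sup (inf x ` A)"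
    unfolding Rep_free_frame_inject[symmetric] rep by (auto simp: rep)
qed

end

lift_definition gen :: "'g \<Rightarrow> 'g free_frame" is "\<lambda>g. {A. finite A \<and> g \<in> A}"
  by auto

text \<open>The formal join of meets \<open>\<Squnion>\<^sub>\<alpha> \<Sqinter> A\<^sub>\<alpha>\<close> belonging to a family of subsets of the generators.\<close>

definition join_of_meets :: "'g set set \<Rightarrow> 'g free_frame" where
  "join_of_meets \<A> = (SUP A\<in>\<A>. INF a\<in>A. gen a)"

section \<open>Presented frames\<close>

text \<open>A relation is a pair \<open>(u, v)\<close> of elements of the free frame, standing for \<open>u \<le> v\<close>.\<close>

type_synonym 'g relations = "('g free_frame \<times> 'g free_frame) set"

definition equation :: "'g free_frame \<Rightarrow> 'g free_frame \<Rightarrow> 'g relations" where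
  "equation u v = {(u, v), (v, u)}"

definition frame_congruence :: "('a::frame \<times> 'a) set \<Rightarrow> bool" where
  "frame_congruence E \<longleftrightarrow> equiv UNIV E \<and>
     (\<forall>u u' v v'. (u, u') \<in> E \<longrightarrow> (v, v') \<in> E \<longrightarrow> (inf u v, inf u' v') \<in> E) \<and>
     (\<forall>P. P \<subseteq> E \<longrightarrow> (Sup (fst ` P), Sup (snd ` P)) \<in> E)"

text \<open>The least frame congruence which forces \<open>u \<le> v\<close>, that is \<open>u \<sqinter> v = u\<close>, for each
  \<open>(u, v)\<close> in \<open>S\<close>. The frame presented by \<open>S\<close> is the quotient of the free frame by it.\<close>

definition generated_congruence :: "'g relations \<Rightarrow> 'g relations" where
  "generated_congruence S =
     \<Inter>{E. frame_congruence E \<and> (\<forall>(u, v)\<in>S. (inf u v, u) \<in> E)}"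

definition presented_frame :: "'g relations \<Rightarrow> 'g free_frame set set" where
  "presented_frame S = UNIV // generated_congruence S"

definition class_of :: "'g relations \<Rightarrow> 'g free_frame \<Rightarrow> 'g free_frame set" where
  "class_of S u = generated_congruence S `` {u}"

definition entails :: "'g relations \<Rightarrow> 'g free_frame \<Rightarrow> 'g free_frame \<Rightarrow> bool" where
  "entails S u v \<longleftrightarrow> (inf u v, u) \<in> generated_congruence S"

definition presented_le :: "'g relations \<Rightarrow> 'g free_frame set \<Rightarrow> 'g free_frame set \<Rightarrow> bool" where
  "presented_le S C D \<longleftrightarrow> (\<exists>u\<in>C. \<exists>v\<in>D. entails S u v)"

text \<open>Isomorphisms of frames are the same as order isomorphisms.\<close>

definition presentation_iso :: "'g relations \<Rightarrow> ('g free_frame set \<Rightarrow> 'a::frame) \<Rightarrow> bool" where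
  "presentation_iso S h \<longleftrightarrow> bij_betw h (presented_frame S) UNIV \<and>
     (\<forall>C\<in>presented_frame S. \<forall>D\<in>presented_frame S. presented_le S C D \<longleftrightarrow> h C \<le> h D)"

section \<open>PreFrm-type presentations over a join semilattice\<close>

text \<open>An element \<open>(\<A>, \<B>)\<close> of \<open>R\<close> is the formal inequality
  \<open>\<Squnion>\<^sub>\<alpha> \<Sqinter> A\<^sub>\<alpha> \<le> \<Squnion>\<^sub>\<beta> \<Sqinter> B\<^sub>\<beta>\<close> with \<open>\<A> = {A\<^sub>\<alpha>}\<close> and \<open>\<B> = {B\<^sub>\<beta>}\<close>.\<close>

definition relations_of :: "('g set set \<times> 'g set set) set \<Rightarrow> 'g relations" where
  "relations_of R = (\<lambda>(\<A>, \<B>). (join_of_meets \<A>, join_of_meets \<B>)) ` R"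

definition semilattice_relations :: "'g::bounded_semilattice_sup_bot relations" where
  "semilattice_relations =
     equation (gen bot) bot \<union> (\<Union>a b. equation (gen (sup a b)) (sup (gen a) (gen b)))"

text \<open>The joins in \<open>R\<close> are directed in the free frame on the join semilattice.\<close>

definition formally_directed :: "'g::bounded_semilattice_sup_bot set set \<Rightarrow> bool" where
  "formally_directed \<A> \<longleftrightarrow> (\<forall>A\<in>\<A>. finite A) \<and>
     directed_wrt (\<lambda>A B. entails semilattice_relations (INF a\<in>A. gen a) (INF b\<in>B. gen b)) \<A>"

definition PreFrm_type :: "('g::bounded_semilattice_sup_bot set set \<times> 'g set set) set \<Rightarrow> bool" where
  "PreFrm_type R \<longleftrightarrow> (\<forall>(\<A>, \<B>)\<in>R. formally_directed \<A> \<and> formally_directed \<B> \<and>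
     (\<forall>c. ((\<lambda>A. (\<lambda>a. sup a c) ` A) ` \<A>, (\<lambda>B. (\<lambda>b. sup b c) ` B) ` \<B>) \<in> R))"

text \<open>\<open>x\<close> is the directed join of the finite meets given by \<open>\<A>\<close>, where \<open>\<eta>\<close> interprets the
  generators.\<close>

definition represents :: "('g \<Rightarrow> 'a::frame) \<Rightarrow> 'g set set \<Rightarrow> 'a \<Rightarrow> bool" where
  "represents \<eta> \<A> x \<longleftrightarrow> (\<forall>A\<in>\<A>. finite A) \<and>
     directed_wrt (\<le>) ((\<lambda>A. INF a\<in>A. \<eta> a) ` \<A>) \<and> x = (SUP A\<in>\<A>. INF a\<in>A. \<eta> a)"

text \<open>With \<open>gen g\<close> in the role of \<open>\<box> g\<close> and \<open>N s\<close> the specified representation of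
  \<open>q\<^sup>* (q\<^sub>* s)\<close>: the relations \<open>\<box> 0 = 0\<close> and \<open>\<box> s \<squnion> \<box> t = \<box> (q\<^sup>* (q\<^sub>* s) \<squnion> q\<^sup>* (q\<^sub>* t))\<close>.\<close>

definition box_relations ::
    "('g::bounded_semilattice_sup_bot \<Rightarrow> 'g set set) \<Rightarrow> 'g relations" where
  "box_relations N = equation (gen bot) bot \<union>
     (\<Union>s t. equation (sup (gen s) (gen t))
        (join_of_meets {(\<lambda>(a, b). sup a b) ` (A \<times> B) | A B. A \<in> N s \<and> B \<in> N t}))"

text \<open>The order of \<open>G\<close>, which the generators keep when \<open>R\<close> is read with \<open>\<box> g\<close> for \<open>g\<close>.
  For arbitrary representations \<open>N\<close> these inequalities need not follow from the others: let
  \<open>G = {0 < s < t}\<close>, \<open>R = {}\<close>, \<open>q\<close> the identity, and represent \<open>0\<close>, \<open>s\<close> by themselves and \<open>t\<close>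
  as the directed join of \<open>0\<close> and \<open>t\<close>. Then the box relations reduce to \<open>\<box> 0 = 0\<close>.\<close>

definition order_relations :: "'g::order relations" where
  "order_relations = {(gen s, gen t) | s t. s \<le> t}"

end

theory Submission
  imports Defs
begin

text \<open>The frame presented by \<open>T\<close> is compared with \<open>OY\<close> through \<open>phi\<close>, which sends \<open>\<box> g\<close> to \<open>q\<^sub>* g\<close>.
  As \<open>R\<close> is stable under joins with elements of \<open>G\<close>, it also presents \<open>OX\<close> as a preframe
  over the poset \<open>G\<close>, so \<open>g \<mapsto> \<box> g\<close> extends to a preframe homomorphism \<open>\<box>\<close> on \<open>OX\<close>. The relation
  \<open>\<box> x \<squnion> \<box> y = \<box> (q\<^sup>* (q\<^sub>* x) \<squnion> q\<^sup>* (q\<^sub>* y))\<close> passes from generators to all of \<open>OX\<close> by directed joins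
  and finite meets, hence \<open>\<box> \<circ> q\<^sup>*\<close> preserves all joins; it is the inverse of \<open>phi\<close>. The frame
  presented by \<open>T\<close> is handled as the free frame preordered by entailment.\<close>

section \<open>Frames\<close>

lemma inf_SUP_frame: "inf x (SUP i\<in>I. f i) = (SUP i\<in>I. inf x (f i))" for x :: "'a::frame"
  by (simp add: inf_Sup_frame image_image)

lemma SUP_inf_frame: "inf (SUP i\<in>I. f i) x = (SUP i\<in>I. inf (f i) x)" for x :: "'a::frame"
  by (simp add: inf.commute[of _ x] inf_SUP_frame)

lemma SUP_inf_SUP_frame:
  "inf (SUP i\<in>I. f i) (SUP j\<in>J. g j) = (SUP i\<in>I. SUP j\<in>J. inf (f i) (g j))"
  for f :: "_ \<Rightarrow> 'a::frame"
  by (simp add: SUP_inf_frame) (simp add: inf_SUP_frame)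

lemma inf_sup_frame: "inf x (sup y z) = sup (inf x y) (inf x z)" for x :: "'a::frame"
  using inf_Sup_frame[of x "{y, z}"] by simp

lemma sup_inf_frame: "sup x (inf y z) = inf (sup x y) (sup x z)" for x :: "'a::frame"
  by (rule distrib_imp1) (rule inf_sup_frame)

lemma sup_INF_frame:
  "finite A \<Longrightarrow> sup x (INF a\<in>A. f a) = (INF a\<in>A. sup x (f a))" for x :: "'a::frame"
  by (induction A rule: finite_induct) (simp_all add: sup_inf_frame)

lemma INF_sup_frame:
  "finite A \<Longrightarrow> sup (INF a\<in>A. f a) x = (INF a\<in>A. sup (f a) x)" for x :: "'a::frame"
  by (simp add: sup.commute[of _ x] sup_INF_frame)

text \<open>Directedness makes both index sets nonempty, which is why the join can be computed over
  the product: each \<open>f i\<close> lies below \<open>sup (f i) (g j0)\<close> for a fixed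
  \<open>j0\<close>, and likewise for \<open>g\<close>.\<close>

lemma directed_SUP_sup:
  fixes f :: "'i \<Rightarrow> 'a::frame" and g :: "'j \<Rightarrow> 'a"
  assumes "directed_wrt (\<le>) (f ` I)" "directed_wrt (\<le>) (g ` J)"
  shows "directed_wrt (\<le>) ((\<lambda>(i, j). sup (f i) (g j)) ` (I \<times> J))"
    and "sup (SUP i\<in>I. f i) (SUP j\<in>J. g j) = (SUP (i, j)\<in>I \<times> J. sup (f i) (g j))"
proof -
  have ne: "I \<noteq> {}" "J \<noteq> {}" using assms by (auto simp: directed_wrt_def)
  have "\<exists>p\<in>I \<times> J. sup (f i) (g j) \<le> sup (f (fst p)) (g (snd p)) \<and>
      sup (f i') (g j') \<le> sup (f (fst p)) (g (snd p))"
    if ij: "i \<in> I" "j \<in> J" "i' \<in> I" "j' \<in> J" for i j i' j'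
  proof -
    obtain i'' where "i'' \<in> I" "f i \<le> f i''" "f i' \<le> f i''"
      using assms(1) ij unfolding directed_wrt_def by blast
    moreover obtain j'' where "j'' \<in> J" "g j \<le> g j''" "g j' \<le> g j''"
      using assms(2) ij unfolding directed_wrt_def by blast
    ultimately show ?thesis by (intro bexI[of _ "(i'', j'')"]) (auto intro: le_supI1 le_supI2)
  qed
  then show "directed_wrt (\<le>) ((\<lambda>(i, j). sup (f i) (g j)) ` (I \<times> J))"
    using ne unfolding directed_wrt_def by (fastforce simp: case_prod_beta)
  show "sup (SUP i\<in>I. f i) (SUP j\<in>J. g j) = (SUP (i, j)\<in>I \<times> J. sup (f i) (g j))" (is "?l = ?r")
  proof (rule antisym)
    obtain i0 j0 where ij: "i0 \<in> I" "j0 \<in> J" using ne by blast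
    have le: "sup (f i) (g j) \<le> ?r" if "i \<in> I" "j \<in> J" for i j
      using that by (intro SUP_upper2[of "(i, j)"]) auto
    have "f i \<le> ?r" if "i \<in> I" for i using le[OF that ij(2)] by simp
    moreover have "g j \<le> ?r" if "j \<in> J" for j using le[OF ij(1) that] by simp
    ultimately show "?l \<le> ?r" by (simp add: SUP_least)
    show "?r \<le> ?l" by (auto intro!: SUP_least sup_mono SUP_upper)
  qed
qed

text \<open>Splits an arbitrary join into finite joins and a directed one; unions of finite subsets
  give the directedness.\<close>

lemma Sup_eq_SUP_finite_subsets:
  fixes Y :: "'a::complete_lattice set"
  shows "Sup Y = (SUP Z\<in>{Z. finite Z \<and> Z \<subseteq> Y}. Sup Z)"
    and "directed_wrt (\<le>) (Sup ` {Z. finite Z \<and> Z \<subseteq> Y})"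
proof -
  have "y \<le> (SUP Z\<in>{Z. finite Z \<and> Z \<subseteq> Y}. Sup Z)" if "y \<in> Y" for y
    by (rule SUP_upper2[of "{y}"]) (use that in auto)
  then show "Sup Y = (SUP Z\<in>{Z. finite Z \<and> Z \<subseteq> Y}. Sup Z)"
    by (intro antisym Sup_least SUP_least) (auto intro: Sup_subset_mono Sup_upper)
  have "\<exists>W. (finite W \<and> W \<subseteq> Y) \<and> Sup Z \<le> Sup W \<and> Sup Z' \<le> Sup W"
    if "finite Z" "Z \<subseteq> Y" "finite Z'" "Z' \<subseteq> Y" for Z Z'
    by (rule exI[of _ "Z \<union> Z'"]) (use that in \<open>auto intro: Sup_subset_mono\<close>)
  then show "directed_wrt (\<le>) (Sup ` {Z. finite Z \<and> Z \<subseteq> Y})"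
    unfolding directed_wrt_def by (auto simp: image_iff)
qed

lemma frame_hom_SUP: "frame_hom f \<Longrightarrow> f (SUP i\<in>I. g i) = (SUP i\<in>I. f (g i))"
  by (simp add: frame_hom_def image_image)

lemma frame_hom_INF: "finite A \<Longrightarrow> frame_hom f \<Longrightarrow> f (INF a\<in>A. g a) = (INF a\<in>A. f (g a))"
  by (induction A rule: finite_induct) (auto simp: frame_hom_def)

lemma frame_hom_mono: "frame_hom f \<Longrightarrow> x \<le> y \<Longrightarrow> f x \<le> f y"
  unfolding frame_hom_def by (metis inf.absorb_iff1)

lemma frame_hom_sup: "frame_hom f \<Longrightarrow> f (sup x y) = sup (f x) (f y)"
  using frame_hom_SUP[of f id "{x, y}"] by simp

lemma frame_hom_bot: "frame_hom f \<Longrightarrow> f bot = bot"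
  using frame_hom_SUP[of f id "{}"] by simp

section \<open>Entailment\<close>

lemma frame_congruence_generated: "frame_congruence (generated_congruence S)"
proof -
  let ?\<E> = "{E. frame_congruence E \<and> (\<forall>(u, v)\<in>S. (inf u v, u) \<in> E)}"
  have equiv: "equiv UNIV E"
    and inf: "\<And>u u' v v'. (u, u') \<in> E \<Longrightarrow> (v, v') \<in> E \<Longrightarrow> (inf u v, inf u' v') \<in> E"
    and Sup: "\<And>P. P \<subseteq> E \<Longrightarrow> (Sup (fst ` P), Sup (snd ` P)) \<in> E" if "E \<in> ?\<E>" for E
    using that unfolding frame_congruence_def by blast+
  have "refl E" "sym E" "trans E" if "E \<in> ?\<E>" for E
    using equiv[OF that] by (simp_all add: equiv_def)
  then have "refl (\<Inter>?\<E>)" "sym (\<Inter>?\<E>)" "trans (\<Inter>?\<E>)"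
    by (intro refl_onI symI transI InterI; meson InterD UNIV_I refl_onD symD transD)+
  then have "equiv UNIV (\<Inter>?\<E>)" by (simp add: equiv_def)
  moreover have "(inf u v, inf u' v') \<in> \<Inter>?\<E>"
    if "(u, u') \<in> \<Inter>?\<E>" "(v, v') \<in> \<Inter>?\<E>" for u u' v v'
    using that by (intro InterI inf) (simp_all only: Inter_iff)
  moreover have "(Sup (fst ` P), Sup (snd ` P)) \<in> \<Inter>?\<E>" if "P \<subseteq> \<Inter>?\<E>" for P
  proof (rule InterI)
    fix E assume E: "E \<in> ?\<E>"
    have "P \<subseteq> E" using that Inter_lower[OF E] by (rule order_trans)
    then show "(Sup (fst ` P), Sup (snd ` P)) \<in> E" by (rule Sup[OF E])
  qed
  ultimately show ?thesis unfolding generated_congruence_def frame_congruence_def by blast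
qed

lemmas generated_congruence =
  frame_congruence_generated[unfolded frame_congruence_def]

lemma generated_congruence_refl: "(u, u) \<in> generated_congruence S"
  using generated_congruence[of S] by (auto simp: equiv_def refl_on_def)

lemma generated_congruence_sym:
  "(u, v) \<in> generated_congruence S \<Longrightarrow> (v, u) \<in> generated_congruence S"
  using generated_congruence[of S] by (auto simp: equiv_def dest: symD)

lemma generated_congruence_trans:
  "(u, v) \<in> generated_congruence S \<Longrightarrow> (v, w) \<in> generated_congruence S \<Longrightarrow>
    (u, w) \<in> generated_congruence S"
  using generated_congruence[of S] by (auto simp: equiv_def dest: transD)

lemma generated_congruence_inf:
  "(u, u') \<in> generated_congruence S \<Longrightarrow> (v, v') \<in> generated_congruence S \<Longrightarrow>
    (inf u v, inf u' v') \<in> generated_congruence S"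
  using generated_congruence[of S] by blast

lemma entails_le: "u \<le> v \<Longrightarrow> entails S u v"
  by (simp add: entails_def inf_absorb1 generated_congruence_refl)

lemma entails_trans [trans]: "entails S u v \<Longrightarrow> entails S v w \<Longrightarrow> entails S u w"
proof -
  assume uv: "entails S u v" and vw: "entails S v w"
  have "(inf (inf u v) w, inf u w) \<in> generated_congruence S"
    using generated_congruence_inf[OF _ generated_congruence_refl] uv unfolding entails_def .
  moreover have "(inf u (inf v w), inf u v) \<in> generated_congruence S"
    using generated_congruence_inf[OF generated_congruence_refl] vw unfolding entails_def .
  ultimately show ?thesis
    using uv unfolding entails_def inf.assoc
    by (meson generated_congruence_sym generated_congruence_trans)
qed

text \<open>The congruence is closed under joins of arbitrary sets of pairs; the frame law then
  pulls the meet with \<open>v\<close> out of the join.\<close>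

lemma entails_Sup: "(\<And>u. u \<in> U \<Longrightarrow> entails S u v) \<Longrightarrow> entails S (Sup U) v"
proof -
  assume *: "\<And>u. u \<in> U \<Longrightarrow> entails S u v"
  let ?P = "(\<lambda>u. (inf v u, u)) ` U"
  have "?P \<subseteq> generated_congruence S" using * by (auto simp: entails_def inf.commute)
  then have "(Sup (fst ` ?P), Sup (snd ` ?P)) \<in> generated_congruence S"
    using generated_congruence[of S] by blast
  then show ?thesis
    by (simp add: entails_def image_image inf.commute[of _ v] inf_Sup_frame)
qed

lemma entails_SUP: "(\<And>i. i \<in> I \<Longrightarrow> entails S (f i) v) \<Longrightarrow> entails S (SUP i\<in>I. f i) v"
  by (rule entails_Sup) auto

lemma entails_SUP_upper: "i \<in> I \<Longrightarrow> entails S u (f i) \<Longrightarrow> entails S u (SUP i\<in>I. f i)"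
  by (meson SUP_upper entails_le entails_trans)

lemma entails_SUP_mono:
  "(\<And>i. i \<in> I \<Longrightarrow> \<exists>j\<in>J. entails S (f i) (g j)) \<Longrightarrow> entails S (SUP i\<in>I. f i) (SUP j\<in>J. g j)"
  by (rule entails_SUP) (blast intro: entails_SUP_upper)

lemma entails_inf: "entails S w u \<Longrightarrow> entails S w v \<Longrightarrow> entails S w (inf u v)"
proof -
  assume "entails S w u" and wv: "entails S w v"
  then have "(inf (inf w u) v, inf w v) \<in> generated_congruence S"
    using generated_congruence_inf[OF _ generated_congruence_refl] unfolding entails_def by blast
  then show ?thesis
    using wv unfolding entails_def inf.assoc by (meson generated_congruence_trans)
qed

lemma entails_INF:
  "finite A \<Longrightarrow> (\<And>a. a \<in> A \<Longrightarrow> entails S w (f a)) \<Longrightarrow> entails S w (INF a\<in>A. f a)"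
  by (induction A rule: finite_induct) (auto intro: entails_inf entails_le)

lemma entails_INF_lower: "a \<in> A \<Longrightarrow> entails S (f a) v \<Longrightarrow> entails S (INF a\<in>A. f a) v"
  by (meson INF_lower entails_le entails_trans)

lemma entails_inf_mono:
  "entails S u u' \<Longrightarrow> entails S v v' \<Longrightarrow> entails S (inf u v) (inf u' v')"
  by (meson entails_inf entails_le entails_trans inf_le1 inf_le2)

lemma entails_sup: "entails S u w \<Longrightarrow> entails S v w \<Longrightarrow> entails S (sup u v) w"
  using entails_Sup[of "{u, v}" S w] by auto

lemma entails_relation: "(u, v) \<in> S \<Longrightarrow> entails S u v"
  unfolding entails_def generated_congruence_def by blast

lemma entails_equation:
  assumes "equation u v \<subseteq> S"
  shows "entails S u v" "entails S v u"
  using assms by (auto simp: equation_def intro: entails_relation)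

text \<open>Lets the preorder \<open>entails\<close> replace the congruence. Forwards, meet the pair
  with \<open>u\<close> and with \<open>v\<close>; backwards, both elements are congruent to
  \<open>inf u v\<close>.\<close>

lemma generated_congruence_iff:
  "(u, v) \<in> generated_congruence S \<longleftrightarrow> entails S u v \<and> entails S v u"
proof
  assume *: "(u, v) \<in> generated_congruence S"
  show "entails S u v \<and> entails S v u"
    using generated_congruence_inf[OF generated_congruence_refl[of u] generated_congruence_sym[OF *]]
      generated_congruence_inf[OF generated_congruence_refl[of v] *]
    unfolding entails_def by simp
next
  assume "entails S u v \<and> entails S v u"
  then show "(u, v) \<in> generated_congruence S"
    unfolding entails_def inf.commute[of v u]
    by (meson generated_congruence_sym generated_congruence_trans)
qed

section \<open>Minimality of the generated congruence\<close>

lemma entails_imp_congruence: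
  assumes "entails S u v" "frame_congruence E" "\<And>u v. (u, v) \<in> S \<Longrightarrow> (inf u v, u) \<in> E"
  shows "(inf u v, u) \<in> E"
  using assms unfolding entails_def generated_congruence_def by blast

text \<open>The kernel of a frame homomorphism is a frame congruence, so minimality applies once
  \<open>f\<close> respects the relations.\<close>

lemma entails_frame_hom:
  assumes "entails S u v" "frame_hom f" "\<And>u v. (u, v) \<in> S \<Longrightarrow> f u \<le> f v"
  shows "f u \<le> f v"
proof -
  let ?E = "{(u, v). f u = f v}"
  have "f (Sup (fst ` P)) = f (Sup (snd ` P))" if "P \<subseteq> ?E" for P
  proof -
    have "f ` fst ` P = f ` snd ` P" unfolding image_image by (rule image_cong) (use that in auto)
    then show ?thesis using assms(2) by (simp add: frame_hom_def)
  qed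
  then have "frame_congruence ?E"
    using assms(2) unfolding frame_congruence_def
    by (auto simp: frame_hom_def equiv_def refl_on_def sym_def trans_def)
  then have "(inf u v, u) \<in> ?E"
    by (rule entails_imp_congruence[OF assms(1)])
      (use assms(2,3) in \<open>auto simp: frame_hom_def inf_absorb1\<close>)
  then show ?thesis using assms(2) by (simp add: frame_hom_def inf.absorb_iff1)
qed

text \<open>The frame law that finite meets commute with directed joins, for entailment and by
  induction on \<open>Y\<close>. The index \<open>k\<close> must serve all \<open>c\<close> at once:
  it merges the index of the new element with the index of the rest.\<close>

lemma entails_directed_INF:
  assumes "finite Y" "I \<noteq> {}"
    and "\<And>i j. i \<in> I \<Longrightarrow> j \<in> I \<Longrightarrow>
      \<exists>k\<in>I. \<forall>c\<in>Y. entails S (g i c) (g k c) \<and> entails S (g j c) (g k c)"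
    and "\<And>c. c \<in> Y \<Longrightarrow> entails S w (SUP i\<in>I. g i c)"
  shows "entails S w (SUP i\<in>I. INF c\<in>Y. g i c)"
  using assms
proof (induction Y rule: finite_induct)
  case empty
  then show ?case by (auto intro: entails_le)
next
  case (insert c Y)
  have "entails S w (SUP i\<in>I. INF c\<in>Y. g i c)"
  proof (rule insert.IH)
    show "\<exists>k\<in>I. \<forall>c\<in>Y. entails S (g i c) (g k c) \<and> entails S (g j c) (g k c)"
      if "i \<in> I" "j \<in> I" for i j
      using insert.prems(2)[OF that] by blast
  qed (use insert.prems in auto)
  then have "entails S w (inf (SUP i\<in>I. g i c) (SUP j\<in>I. INF c\<in>Y. g j c))"
    using insert.prems(3) by (auto intro: entails_inf)
  moreover have "entails S (inf (g i c) (INF c\<in>Y. g j c)) (SUP i\<in>I. INF c\<in>insert c Y. g i c)"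
    if ij: "i \<in> I" "j \<in> I" for i j
  proof -
    obtain k where k: "k \<in> I"
      "\<forall>c\<in>insert c Y. entails S (g i c) (g k c) \<and> entails S (g j c) (g k c)"
      using insert.prems(2)[OF ij] by blast
    have "entails S (INF c\<in>Y. g j c) (INF c\<in>Y. g k c)"
      using k insert.hyps by (auto intro!: entails_INF intro: entails_INF_lower)
    then have "entails S (inf (g i c) (INF c\<in>Y. g j c)) (INF c\<in>insert c Y. g k c)"
      using k by (auto intro: entails_inf_mono)
    with k(1) show ?thesis by (rule entails_SUP_upper)
  qed
  ultimately show ?case
    unfolding SUP_inf_SUP_frame by (meson entails_trans entails_SUP)
qed

section \<open>Interpretations of the free frame\<close>

lemma finite_Rep_free_frame: "A \<in> Rep_free_frame u \<Longrightarrow> finite A"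
  using Rep_free_frame[of u] by auto

lemma Rep_free_frame_upward:
  "A \<in> Rep_free_frame u \<Longrightarrow> finite B \<Longrightarrow> A \<subseteq> B \<Longrightarrow> B \<in> Rep_free_frame u"
  using Rep_free_frame[of u] by blast

lemma Rep_INF_gen: "Rep_free_frame (INF a\<in>A. gen a) = {B. finite B \<and> A \<subseteq> B}"
  by (auto simp: Inf_free_frame.rep_eq gen.rep_eq)

lemma Rep_join_of_meets:
  "Rep_free_frame (join_of_meets \<A>) = {B. finite B \<and> (\<exists>A\<in>\<A>. A \<subseteq> B)}"
  by (auto simp: join_of_meets_def Sup_free_frame.rep_eq Rep_INF_gen)

text \<open>Upward closure makes the representing family a normal form, so every element is a join
  of finite meets of generators.\<close>

lemma join_of_meets_Rep: "join_of_meets (Rep_free_frame u) = u"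
  unfolding Rep_free_frame_inject[symmetric] Rep_join_of_meets
  by (auto intro: finite_Rep_free_frame Rep_free_frame_upward)

text \<open>The extension of \<open>f\<close> to a frame homomorphism, as provided by the universal
  property of the free frame.\<close>

definition interpret_free :: "('g \<Rightarrow> 'a::frame) \<Rightarrow> 'g free_frame \<Rightarrow> 'a" where
  "interpret_free f u = (SUP A\<in>Rep_free_frame u. INF a\<in>A. f a)"

lemma frame_hom_interpret_free: "frame_hom (interpret_free f)"
  unfolding frame_hom_def
proof (intro conjI allI)
  fix U :: "'a free_frame set" and u v :: "'a free_frame"
  show "interpret_free f (Sup U) = Sup (interpret_free f ` U)"
    by (simp add: interpret_free_def Sup_free_frame.rep_eq SUP_UNION)
  show "interpret_free f top = top"
    unfolding interpret_free_def top_free_frame.rep_eq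
    by (rule top_le) (auto intro!: SUP_upper2[of "{}"])
  show "interpret_free f (inf u v) = inf (interpret_free f u) (interpret_free f v)" (is "?l = ?r")
  proof (rule antisym)
    show "?l \<le> ?r"
      unfolding interpret_free_def inf_free_frame.rep_eq by (auto intro: SUP_subset_mono)
    have "inf (INF a\<in>A. f a) (INF a\<in>B. f a) \<le> ?l"
      if "A \<in> Rep_free_frame u" "B \<in> Rep_free_frame v" for A B
    proof -
      have "A \<union> B \<in> Rep_free_frame (inf u v)"
        using that finite_Rep_free_frame[OF that(1)] finite_Rep_free_frame[OF that(2)]
        by (auto simp: inf_free_frame.rep_eq intro: Rep_free_frame_upward)
      then show ?thesis
        unfolding interpret_free_def INF_union[symmetric] by (rule SUP_upper)
    qed
    then show "?r \<le> ?l"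
      unfolding interpret_free_def[of f u] interpret_free_def[of f v] SUP_inf_SUP_frame
      by (blast intro: SUP_least)
  qed
qed

lemma interpret_free_gen [simp]: "interpret_free f (gen g) = f g"
proof (rule antisym)
  show "interpret_free f (gen g) \<le> f g"
    unfolding interpret_free_def gen.rep_eq by (auto intro!: SUP_least INF_lower)
  show "f g \<le> interpret_free f (gen g)"
    unfolding interpret_free_def gen.rep_eq by (rule SUP_upper2[of "{g}"]) auto
qed

lemma interpret_free_INF_gen:
  "finite A \<Longrightarrow> interpret_free f (INF a\<in>A. gen a) = (INF a\<in>A. f a)"
  by (simp add: frame_hom_INF frame_hom_interpret_free)

lemma interpret_free_join_of_meets:
  assumes "\<forall>A\<in>\<A>. finite A"
  shows "interpret_free f (join_of_meets \<A>) = (SUP A\<in>\<A>. INF a\<in>A. f a)"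
  unfolding join_of_meets_def frame_hom_SUP[OF frame_hom_interpret_free]
  by (rule SUP_cong) (use assms in \<open>auto simp: interpret_free_INF_gen\<close>)

text \<open>The uniqueness half of the universal property: a homomorphism is determined on the
  normal form by its values on generators.\<close>

lemma frame_hom_eq_interpret_free:
  assumes "frame_hom k"
  shows "k = interpret_free (\<lambda>g. k (gen g))"
proof
  fix u
  have "k u = k (join_of_meets (Rep_free_frame u))" by (simp add: join_of_meets_Rep)
  also have "\<dots> = (SUP A\<in>Rep_free_frame u. INF a\<in>A. k (gen a))"
    unfolding join_of_meets_def frame_hom_SUP[OF assms]
    by (rule SUP_cong) (auto simp: frame_hom_INF[OF _ assms] dest: finite_Rep_free_frame)
  finally show "k u = interpret_free (\<lambda>g. k (gen g)) u" by (simp add: interpret_free_def)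
qed

section \<open>Presented frames as surjections from the free frame that reflect entailment\<close>

definition presents :: "'g relations \<Rightarrow> ('g \<Rightarrow> 'a::frame) \<Rightarrow> bool" where
  "presents S f \<longleftrightarrow> surj (interpret_free f) \<and>
     (\<forall>u v. interpret_free f u \<le> interpret_free f v \<longleftrightarrow> entails S u v)"

lemma presented_le_class_of: "presented_le S (class_of S u) (class_of S v) \<longleftrightarrow> entails S u v"
  unfolding presented_le_def class_of_def Image_singleton_iff generated_congruence_iff Bex_def
  by (blast intro: entails_trans entails_le[OF order_refl])

lemma class_of_in_presented_frame: "class_of S u \<in> presented_frame S"
  unfolding class_of_def presented_frame_def by (rule quotientI) simp

lemma presented_frame_cases:
  assumes "C \<in> presented_frame S"
  obtains u where "C = class_of S u"
  using assms unfolding class_of_def presented_frame_def by (auto elim: quotientE)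

text \<open>The composite \<open>k\<close> of the class map with \<open>\<kappa>\<close> is onto and
  turns entailment into the order. Each join or meet in the target is therefore some
  \<open>k w\<close>, and comparing it with \<open>k\<close> of the formal one reduces to the rules
  for \<open>entails\<close>.\<close>

lemma presentation_iso_imp_presents:
  assumes "presentation_iso S \<kappa>"
  shows "presents S (\<lambda>g. \<kappa> (class_of S (gen g)))"
proof -
  define k where "k u = \<kappa> (class_of S u)" for u
  have le: "k u \<le> k v \<longleftrightarrow> entails S u v" for u v
    using assms class_of_in_presented_frame[of S] presented_le_class_of[of S u v]
    unfolding presentation_iso_def k_def by blast
  have surj: "\<exists>u. y = k u" for y
  proof -
    have "y \<in> \<kappa> ` presented_frame S"
      using assms by (simp add: presentation_iso_def bij_betw_def)
    then show ?thesis unfolding k_def by (auto elim!: presented_frame_cases)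
  qed
  have "frame_hom k"
    unfolding frame_hom_def
  proof (intro conjI allI antisym)
    fix U u v
    obtain w where w: "Sup (k ` U) = k w" using surj by blast
    have "k u \<le> k w" if "u \<in> U" for u using that w by (metis SUP_upper)
    then have "entails S (Sup U) w" by (auto simp: le intro: entails_Sup)
    then show "k (Sup U) \<le> Sup (k ` U)" by (simp add: w le)
    show "Sup (k ` U) \<le> k (Sup U)" by (auto intro!: SUP_least entails_le Sup_upper simp: le)
    obtain t where t: "top = k t" using surj by blast
    show "top \<le> k top" unfolding t le by (simp add: entails_le)
    show "k (inf u v) \<le> inf (k u) (k v)" by (simp add: le entails_le)
    obtain z where z: "inf (k u) (k v) = k z" using surj by blast
    then have "entails S z u" "entails S z v" unfolding le[symmetric] by (metis inf_le1 inf_le2)+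
    then show "inf (k u) (k v) \<le> k (inf u v)" unfolding z le by (rule entails_inf)
  qed simp
  then have "interpret_free (\<lambda>g. \<kappa> (class_of S (gen g))) = k"
    using frame_hom_eq_interpret_free unfolding k_def by force
  with le surj show ?thesis by (auto simp: presents_def surj_def)
qed

text \<open>A class is sent to the value of a chosen representative. The choice does not matter,
  since equivalent elements entail each other and so have equal values by antisymmetry.\<close>

lemma presents_imp_presentation_iso:
  fixes f :: "'g \<Rightarrow> 'a::frame"
  assumes "presents S f"
  shows "\<exists>h :: 'g free_frame set \<Rightarrow> 'a. presentation_iso S h"
proof -
  define h where "h C = interpret_free f (SOME u. C = class_of S u)" for C
  have le: "interpret_free f u \<le> interpret_free f v \<longleftrightarrow> entails S u v" for u v
    using assms by (simp add: presents_def)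
  have class_eq: "class_of S u = class_of S v \<longleftrightarrow> entails S u v \<and> entails S v u" for u v
    unfolding class_of_def generated_congruence_iff[symmetric]
    by (rule eq_equiv_class_iff) (use generated_congruence[of S] in auto)
  have h: "h (class_of S u) = interpret_free f u" for u
  proof -
    have "class_of S u = class_of S (SOME v. class_of S u = class_of S v)"
      by (rule someI_ex) blast
    then show ?thesis unfolding h_def class_eq by (intro antisym) (simp_all add: le)
  qed
  have "presentation_iso S h"
    unfolding presentation_iso_def bij_betw_def
  proof (intro conjI ballI)
    show "inj_on h (presented_frame S)"
      by (rule inj_onI, elim presented_frame_cases) (simp add: h class_eq le[symmetric])
    show "h ` presented_frame S = UNIV"
    proof -
      have "y \<in> h ` presented_frame S" for y
      proof -
        obtain u where "y = interpret_free f u"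
          using assms unfolding presents_def surj_def by blast
        then show ?thesis using h class_of_in_presented_frame by (metis image_eqI)
      qed
      then show ?thesis by blast
    qed
    show "presented_le S C D \<longleftrightarrow> h C \<le> h D"
      if "C \<in> presented_frame S" "D \<in> presented_frame S" for C D
      using that by (elim presented_frame_cases) (simp add: h presented_le_class_of le)
  qed
  then show ?thesis by blast
qed

section \<open>Finite meets of generators\<close>

text \<open>The free distributive lattice on the join semilattice \<open>'g\<close> consists of the finite
  subsets, \<open>A\<close> standing for \<open>\<Sqinter> A\<close>: \<open>refines\<close> is its preorder, union is its meet and
  \<open>joins\<close> is its join.\<close>

definition refines :: "'g::order set \<Rightarrow> 'g set \<Rightarrow> bool" where
  "refines A B \<longleftrightarrow> (\<forall>b\<in>B. \<exists>a\<in>A. a \<le> b)"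

abbreviation joins :: "'g::semilattice_sup set \<Rightarrow> 'g set \<Rightarrow> 'g set" where
  "joins A B \<equiv> (\<lambda>(a, b). sup a b) ` (A \<times> B)"

lemma refines_joins1: "refines A (joins A B)" and refines_joins2: "refines B (joins A B)"
  by (auto simp: refines_def intro: sup_ge1 sup_ge2)

lemma refines_trans: "refines A B \<Longrightarrow> refines B C \<Longrightarrow> refines A C"
  unfolding refines_def by (meson order_trans)

lemma refines_refl: "refines A A"
  by (auto simp: refines_def)

lemma joins_least: "refines A C \<Longrightarrow> refines B C \<Longrightarrow> refines (joins A B) C"
  unfolding refines_def by (simp add: Bex_def) (metis le_supI)

lemma joins_refines_mono: "refines A C \<Longrightarrow> refines B D \<Longrightarrow> refines (joins A B) (joins C D)"
  by (rule joins_least; erule refines_trans; rule refines_joins1 refines_joins2)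

lemma refines_joins_assoc: "refines (joins (joins A B) C) (joins A (joins B C))"
  by (intro joins_least)
    (rule refines_joins1 refines_trans[OF refines_joins1 refines_joins2]
      refines_trans[OF refines_joins2 refines_joins2])+

lemma refines_joins_left_commute: "refines (joins A (joins B C)) (joins B (joins A C))"
  by (intro joins_least)
    (rule refines_joins1 refines_trans[OF refines_joins1 refines_joins2]
      refines_trans[OF refines_joins2 refines_joins2])+

text \<open>Mere regrouping, so \<open>f\<close> can be any function. It lets
  \<open>PreFrm_type_coverage\<close> treat the elements of \<open>Y\<close> one at a time.\<close>

lemma INF_joins: "(INF x\<in>joins A B. f x) = (INF b\<in>B. INF a\<in>A. f (sup a b))"
  for f :: "_ \<Rightarrow> 'a::complete_lattice"
  by (rule antisym) (auto intro!: INF_greatest INF_lower2)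

text \<open>For join-preserving \<open>f\<close>, \<open>joins\<close> computes the actual join of
  two meets, by distributivity over finite meets.\<close>

lemma INF_joins_sup:
  fixes f :: "'g::semilattice_sup \<Rightarrow> 'a::frame"
  assumes "finite A" "finite B" "\<And>a b. f (sup a b) = sup (f a) (f b)"
  shows "(INF x\<in>joins A B. f x) = sup (INF a\<in>A. f a) (INF b\<in>B. f b)"
proof -
  have "(INF x\<in>joins A B. f x) = (INF b\<in>B. sup (INF a\<in>A. f a) (f b))"
    unfolding INF_joins assms(3)
    by (simp only: INF_sup_frame[OF assms(1)])
  then show ?thesis by (simp add: sup_INF_frame[OF assms(2)])
qed

lemma entails_INF_refines:
  assumes "\<And>s t. s \<le> t \<Longrightarrow> entails T (f s) (f t)" "finite B" "refines A B"
  shows "entails T (INF a\<in>A. f a) (INF b\<in>B. f b)"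
proof (rule entails_INF[OF assms(2)])
  fix b assume "b \<in> B"
  then obtain a where "a \<in> A" "a \<le> b" using assms(3) by (auto simp: refines_def)
  then show "entails T (INF a\<in>A. f a) (f b)" using assms(1) by (meson entails_INF_lower)
qed

text \<open>An induction principle for entailment: a property \<open>K\<close> of finite meets
  passes from \<open>v\<close> to \<open>u\<close> if every relation transports it, stably under
  meets with any finite \<open>C\<close>.\<close>

lemma entails_imp_subset:
  assumes "entails S u v" "Rep_free_frame v \<subseteq> K"
    and up: "\<And>X Z. X \<in> K \<Longrightarrow> finite Z \<Longrightarrow> X \<subseteq> Z \<Longrightarrow> Z \<in> K"
    and closed: "\<And>u v C. (u, v) \<in> S \<Longrightarrow> finite C \<Longrightarrow> (\<forall>B\<in>Rep_free_frame v. B \<union> C \<in> K) \<Longrightarrow>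
      (\<forall>A\<in>Rep_free_frame u. A \<union> C \<in> K)"
  shows "Rep_free_frame u \<subseteq> K"
proof -
  \<comment> \<open>\<open>Q u C\<close> says that the meet of \<open>u\<close> with the meet of
    \<open>C\<close> stays inside \<open>K\<close>. Carrying \<open>C\<close> along is what makes
    equality of all \<open>Q u\<close> and \<open>Q v\<close> a congruence for meets.\<close>
  define Q where "Q u C \<longleftrightarrow> (\<forall>A\<in>Rep_free_frame u. A \<union> C \<in> K)" for u C
  let ?E = "{(u, v). \<forall>C. finite C \<longrightarrow> Q u C = Q v C}"
  have Q_inf: "Q (inf u v) C \<longleftrightarrow> (\<forall>A\<in>Rep_free_frame u. Q v (A \<union> C))" for u v C
  proof
    assume *: "Q (inf u v) C"
    have "B \<union> (A \<union> C) \<in> K" if "A \<in> Rep_free_frame u" "B \<in> Rep_free_frame v" for A B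
    proof -
      have "A \<union> B \<in> Rep_free_frame (inf u v)"
        using that finite_Rep_free_frame[OF that(1)] finite_Rep_free_frame[OF that(2)]
        by (auto simp: inf_free_frame.rep_eq intro: Rep_free_frame_upward)
      then show ?thesis using * unfolding Q_def by (metis Un_assoc Un_commute)
    qed
    then show "\<forall>A\<in>Rep_free_frame u. Q v (A \<union> C)" unfolding Q_def by blast
  next
    assume *: "\<forall>A\<in>Rep_free_frame u. Q v (A \<union> C)"
    have "A \<union> (A \<union> C) \<in> K" if "A \<in> Rep_free_frame (inf u v)" for A
      using that * unfolding Q_def inf_free_frame.rep_eq by blast
    then show "Q (inf u v) C" unfolding Q_def by simp
  qed
  have Q_cong_inf: "Q (inf u v) C \<longleftrightarrow> Q (inf u' v') C"
    if "(u, u') \<in> ?E" "(v, v') \<in> ?E" "finite C" for u u' v v' C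
  proof -
    have "Q (inf u v) C \<longleftrightarrow> Q (inf u v') C"
      using that unfolding Q_inf by (simp add: finite_Rep_free_frame)
    also have "\<dots> \<longleftrightarrow> Q (inf v' u) C" by (simp add: inf.commute)
    also have "\<dots> \<longleftrightarrow> Q (inf v' u') C"
      using that unfolding Q_inf by (simp add: finite_Rep_free_frame)
    finally show ?thesis by (simp add: inf.commute)
  qed
  have Q_Sup: "Q (Sup U) C \<longleftrightarrow> (\<forall>u\<in>U. Q u C)" for U C
    unfolding Q_def by (auto simp: Sup_free_frame.rep_eq)
  have "frame_congruence ?E"
    unfolding frame_congruence_def
  proof (intro conjI allI impI)
    show "equiv UNIV ?E" by (auto simp: equiv_def refl_on_def sym_def trans_def)
    show "(inf u v, inf u' v') \<in> ?E" if "(u, u') \<in> ?E" "(v, v') \<in> ?E" for u u' v v'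
      using Q_cong_inf[OF that] by simp
    show "(Sup (fst ` P), Sup (snd ` P)) \<in> ?E" if "P \<subseteq> ?E" for P
      using that by (fastforce simp: Q_Sup)
  qed
  moreover have "(inf u v, u) \<in> ?E" if "(u, v) \<in> S" for u v
  proof -
    have "Q u C" if C: "finite C" and inf: "Q (inf u v) C" for C
      unfolding Q_def
    proof
      fix A assume A: "A \<in> Rep_free_frame u"
      then have "Q v (A \<union> C)" using inf by (simp add: Q_inf)
      \<comment> \<open>The relation is applied with \<open>A \<union> C\<close> in place of
        \<open>C\<close>; adding \<open>A\<close> a second time changes nothing.\<close>
      then have "Q u (A \<union> C)"
        using closed[OF \<open>(u, v) \<in> S\<close>, of "A \<union> C"] C finite_Rep_free_frame[OF A]
        unfolding Q_def by simp
      then have "A \<union> (A \<union> C) \<in> K" using A unfolding Q_def by blast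
      then show "A \<union> C \<in> K" by simp
    qed
    moreover have "Q (inf u v) C" if "Q u C" for C
      using that unfolding Q_def inf_free_frame.rep_eq by blast
    ultimately show ?thesis by blast
  qed
  ultimately have "(inf u v, u) \<in> ?E" by (rule entails_imp_congruence[OF assms(1)])
  then have "Q (inf u v) {} = Q u {}" by simp
  moreover have "Q (inf u v) {}"
    using assms(2) unfolding Q_def inf_free_frame.rep_eq by auto
  ultimately show ?thesis unfolding Q_def by auto
qed

section \<open>The coverage theorem for preframes\<close>

text \<open>Since \<open>f\<close> does not preserve joins, the \<open>X\<close> whose image lies below that of \<open>J\<close> do not form
  an ideal; the set \<open>K\<close> asks for this stably under joins with arbitrary \<open>Y\<close>, and is one.\<close>

lemma coverage:
  fixes R :: "('g::bounded_semilattice_sup_bot set set \<times> 'g set set) set"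
    and f :: "'g \<Rightarrow> 'h free_frame"
  assumes mono: "\<And>s t. s \<le> t \<Longrightarrow> entails T (f s) (f t)"
    and fin_R: "\<And>\<A> \<B> A. (\<A>, \<B>) \<in> R \<Longrightarrow> A \<in> \<A> \<union> \<B> \<Longrightarrow> finite A"
    and cover: "\<And>\<A> \<B> A Y. (\<A>, \<B>) \<in> R \<Longrightarrow> A \<in> \<A> \<Longrightarrow> finite Y \<Longrightarrow>
      entails T (INF x\<in>joins A Y. f x) (SUP B\<in>\<B>. INF x\<in>joins B Y. f x)"
    and J_ne: "J \<noteq> {}" and J_fin: "\<And>D. D \<in> J \<Longrightarrow> finite D"
    and J_dir: "\<And>D D'. D \<in> J \<Longrightarrow> D' \<in> J \<Longrightarrow> \<exists>D''\<in>J. refines D D'' \<and> refines D' D''"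
    and ent: "entails (semilattice_relations \<union> relations_of R) (INF a\<in>A. gen a) (join_of_meets J)"
    and "finite A"
  shows "entails T (INF a\<in>A. f a) (SUP D\<in>J. INF a\<in>D. f a)"
proof -
  let ?m = "\<lambda>X. INF x\<in>X. f x"
  define K where "K = {X. finite X \<and>
    (\<forall>Y. finite Y \<longrightarrow> entails T (?m (joins X Y)) (SUP D\<in>J. ?m (joins D Y)))}"
  have m_mono: "entails T (?m X) (?m Z)" if "finite Z" "refines X Z" for X Z
    using entails_INF_refines[OF mono that] .
  have K_refines: "Z \<in> K" if "X \<in> K" "finite Z" "refines Z X" for X Z
  proof -
    have "entails T (?m (joins Z Y)) (SUP D\<in>J. ?m (joins D Y))" if Y: "finite Y" for Y
    proof (rule entails_trans)
      show "entails T (?m (joins Z Y)) (?m (joins X Y))"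
        using Y \<open>X \<in> K\<close> \<open>refines Z X\<close>
        by (intro m_mono joins_refines_mono) (auto simp: K_def refines_def)
    qed (use \<open>X \<in> K\<close> Y in \<open>auto simp: K_def\<close>)
    then show ?thesis using \<open>finite Z\<close> by (simp add: K_def)
  qed
  have up: "Z \<in> K" if "X \<in> K" "finite Z" "X \<subseteq> Z" for X Z
    by (rule K_refines[OF that(1,2)]) (use that in \<open>auto simp: refines_def\<close>)
  have K_J: "D \<in> K" if "D \<in> J" for D
    using that J_fin by (auto simp: K_def intro: entails_SUP_upper entails_le)
  \<comment> \<open>First \<open>X\<close> is used with \<open>joins X' Y\<close> in place of
    \<open>Y\<close>, which yields some \<open>D\<close>; then \<open>X'\<close> with
    \<open>joins D Y\<close>, which yields some \<open>D'\<close>. Directedness of \<open>J\<close>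
    merges \<open>D\<close> and \<open>D'\<close>.\<close>
  have K_joins: "joins X X' \<in> K" if X: "X \<in> K" and X': "X' \<in> K" for X X'
  proof -
    have "entails T (?m (joins (joins X X') Y)) (SUP D\<in>J. ?m (joins D Y))" if Y: "finite Y" for Y
    proof -
      have fin: "finite X" "finite X'" using X X' by (auto simp: K_def)
      have "entails T (?m (joins (joins X X') Y)) (?m (joins X (joins X' Y)))"
        using fin Y by (intro m_mono refines_joins_assoc) auto
      also have "entails T \<dots> (SUP D\<in>J. ?m (joins D (joins X' Y)))"
        using X fin Y by (auto simp: K_def)
      also have "entails T \<dots> (SUP D\<in>J. ?m (joins D Y))"
      proof (rule entails_SUP)
        fix D assume D: "D \<in> J"
        have "entails T (?m (joins D (joins X' Y))) (?m (joins X' (joins D Y)))"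
          using fin Y J_fin[OF D] by (intro m_mono refines_joins_left_commute) auto
        also have "entails T \<dots> (SUP D'\<in>J. ?m (joins D' (joins D Y)))"
          using X' Y J_fin[OF D] by (auto simp: K_def)
        also have "entails T \<dots> (SUP D\<in>J. ?m (joins D Y))"
        proof (rule entails_SUP)
          fix D' assume "D' \<in> J"
          then obtain D'' where D'': "D'' \<in> J" "refines D D''" "refines D' D''"
            using J_dir[OF D] by blast
          have "refines (joins D' (joins D Y)) (joins D'' Y)"
            by (rule joins_least[OF refines_trans[OF D''(3) refines_joins1]
                joins_refines_mono[OF D''(2) refines_refl]])
          then have "entails T (?m (joins D' (joins D Y))) (?m (joins D'' Y))"
            using D'' Y J_fin by (intro m_mono) auto
          with D''(1) show "entails T (?m (joins D' (joins D Y))) (SUP D\<in>J. ?m (joins D Y))"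
            by (rule entails_SUP_upper)
        qed
        finally show "entails T (?m (joins D (joins X' Y))) (SUP D\<in>J. ?m (joins D Y))" .
      qed
      finally show ?thesis .
    qed
    then show ?thesis using X X' by (simp add: K_def)
  qed
  have "Rep_free_frame (INF a\<in>A. gen a) \<subseteq> K"
  proof (rule entails_imp_subset[OF ent])
    show "Rep_free_frame (join_of_meets J) \<subseteq> K"
      by (auto simp: Rep_join_of_meets intro: up K_J)
    show "Z \<in> K" if "X \<in> K" "finite Z" "X \<subseteq> Z" for X Z using up[OF that] .
    fix u v :: "'g free_frame" and C
    assume uv: "(u, v) \<in> semilattice_relations \<union> relations_of R"
      and C: "finite C" and v: "\<forall>B\<in>Rep_free_frame v. B \<union> C \<in> K"
    show "\<forall>A\<in>Rep_free_frame u. A \<union> C \<in> K"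
    proof
      fix A assume A: "A \<in> Rep_free_frame u"
      have fA: "finite A" using A by (rule finite_Rep_free_frame)
      consider "u = gen bot" | "u = bot"
        | a b where "u = gen (sup a b)" "v = sup (gen a) (gen b)"
        | a b where "u = sup (gen a) (gen b)" "v = gen (sup a b)"
        | \<A> \<B> where "(\<A>, \<B>) \<in> R" "u = join_of_meets \<A>" "v = join_of_meets \<B>"
        using uv by (auto simp: semilattice_relations_def equation_def relations_of_def)
      then show "A \<union> C \<in> K"
      proof cases
        case 1
        obtain D where D: "D \<in> J" using J_ne by blast
        have "bot \<in> A" using A 1 by (simp add: gen.rep_eq)
        \<comment> \<open>A set containing \<open>bot\<close> refines every set, so a single member
          of \<open>J\<close> suffices.\<close>
        then have "refines (A \<union> C) D" by (auto simp: refines_def intro!: bexI[of _ bot])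
        then show ?thesis using K_refines[OF K_J[OF D]] fA C by simp
      next
        case 2
        then show ?thesis using A by (simp add: bot_free_frame.rep_eq)
      next
        case (3 a b)
        have "{a} \<union> C \<in> K" "{b} \<union> C \<in> K"
          using bspec[OF v, of "{a}"] bspec[OF v, of "{b}"]
          by (simp_all add: 3 sup_free_frame.rep_eq gen.rep_eq)
        \<comment> \<open>Each element of these joins is \<open>sup a b\<close> or lies above an
          element of \<open>C\<close>.\<close>
        then have "joins ({a} \<union> C) ({b} \<union> C) \<in> K" by (rule K_joins)
        moreover have "refines (A \<union> C) (joins ({a} \<union> C) ({b} \<union> C))"
          using A unfolding 3 gen.rep_eq by (auto simp: refines_def intro: sup.coboundedI1 sup.coboundedI2)
        ultimately show ?thesis using K_refines fA C by blast
      next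
        case (4 a b)
        have "{sup a b} \<union> C \<in> K" using bspec[OF v, of "{sup a b}"] by (simp add: 4 gen.rep_eq)
        moreover have "refines (A \<union> C) ({sup a b} \<union> C)"
          using A unfolding 4
          by (auto simp: sup_free_frame.rep_eq gen.rep_eq refines_def
              intro: bexI[of _ a] bexI[of _ b])
        ultimately show ?thesis using K_refines fA C by blast
      next
        case (5 \<A> \<B>)
        obtain A0 where A0: "A0 \<in> \<A>" "A0 \<subseteq> A" using A by (auto simp: 5 Rep_join_of_meets)
        have fA0: "finite A0" using A0 fA finite_subset by blast
        have BC: "B \<union> C \<in> K" if "B \<in> \<B>" for B
          using v that fin_R[OF 5(1)] by (auto simp: 5 Rep_join_of_meets)
        have "entails T (?m (joins (A0 \<union> C) Y)) (SUP D\<in>J. ?m (joins D Y))" if Y: "finite Y" for Y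
        proof -
          \<comment> \<open>The part coming from \<open>C\<close> is split off so that
            \<open>cover\<close> applies to \<open>A0\<close> alone; afterwards it is distributed
            over the \<open>B\<close> and merged back.\<close>
          have split: "?m (joins (X \<union> C) Y) = inf (?m (joins X Y)) (?m (joins C Y))" for X
            unfolding INF_union[symmetric] by (rule arg_cong[of _ _ ?m]) auto
          have "entails T (?m (joins (A0 \<union> C) Y)) (inf (SUP B\<in>\<B>. ?m (joins B Y)) (?m (joins C Y)))"
            unfolding split
            by (rule entails_inf_mono[OF cover[OF 5(1) A0(1) Y] entails_le[OF order_refl]])
          also have "entails T \<dots> (SUP D\<in>J. ?m (joins D Y))"
            unfolding inf.commute[of _ "?m (joins C Y)"] inf_SUP_frame
          proof (rule entails_SUP)
            fix B assume "B \<in> \<B>"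
            then have "entails T (?m (joins (B \<union> C) Y)) (SUP D\<in>J. ?m (joins D Y))"
              using BC Y by (simp add: K_def)
            then show "entails T (inf (?m (joins C Y)) (?m (joins B Y))) (SUP D\<in>J. ?m (joins D Y))"
              unfolding split inf.commute[of "?m (joins C Y)"] .
          qed
          finally show ?thesis .
        qed
        then have "A0 \<union> C \<in> K" using fA0 C by (simp add: K_def)
        then show ?thesis by (rule up) (use A0 fA C in auto)
      qed
    qed
  qed
  then have "A \<in> K" using \<open>finite A\<close> by (auto simp: Rep_INF_gen)
  \<comment> \<open>Joining with \<open>{bot}\<close> changes nothing, so this instance of the
    stable property is the claim itself.\<close>
  then have "entails T (?m (joins A {bot})) (SUP D\<in>J. ?m (joins D {bot}))" by (simp add: K_def)
  then show ?thesis by (simp add: INF_joins)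
qed

text \<open>Coverage with no relations, the single cover \<open>{B}\<close> and the shifted map
  \<open>\<lambda>a. f (sup a c)\<close>, which is still monotone. It carries formal directedness
  over to families joined with \<open>c\<close>.\<close>

lemma entails_semilattice_joins:
  fixes f :: "'g::bounded_semilattice_sup_bot \<Rightarrow> 'h free_frame"
  assumes mono: "\<And>s t. s \<le> t \<Longrightarrow> entails T (f s) (f t)"
    and "entails semilattice_relations (INF a\<in>A. gen a) (INF b\<in>B. gen b)" "finite A" "finite B"
  shows "entails T (INF a\<in>A. f (sup a c)) (INF b\<in>B. f (sup b c))"
proof -
  have "entails T (INF a\<in>A. f (sup a c)) (SUP D\<in>{B}. INF a\<in>D. f (sup a c))"
  proof (rule coverage[where R = "{}"])
    show "entails T (f (sup s c)) (f (sup t c))" if "s \<le> t" for s t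
      by (rule mono) (use that in \<open>simp add: le_supI1\<close>)
  qed (use assms in \<open>auto simp: join_of_meets_def relations_of_def refines_def\<close>)
  then show ?thesis by simp
qed

text \<open>\<open>R\<close> is closed under joins with one \<open>c\<close>, whereas
  \<open>coverage\<close> asks for stability under a finite \<open>Y\<close>. The gap is a finite
  meet over \<open>c \<in> Y\<close> of directed joins, bridged by
  \<open>entails_directed_INF\<close>.\<close>

lemma PreFrm_type_coverage:
  fixes R :: "('g::bounded_semilattice_sup_bot set set \<times> 'g set set) set"
    and f :: "'g \<Rightarrow> 'h free_frame"
  assumes R: "PreFrm_type R"
    and mono: "\<And>s t. s \<le> t \<Longrightarrow> entails T (f s) (f t)"
    and rel: "\<And>\<A> \<B>. (\<A>, \<B>) \<in> R \<Longrightarrow>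
      entails T (SUP A\<in>\<A>. INF a\<in>A. f a) (SUP B\<in>\<B>. INF b\<in>B. f b)"
    and "J \<noteq> {}" "\<And>D. D \<in> J \<Longrightarrow> finite D"
    and "\<And>D D'. D \<in> J \<Longrightarrow> D' \<in> J \<Longrightarrow> \<exists>D''\<in>J. refines D D'' \<and> refines D' D''"
    and "entails (semilattice_relations \<union> relations_of R) (INF a\<in>A. gen a) (join_of_meets J)"
    and "finite A"
  shows "entails T (INF a\<in>A. f a) (SUP D\<in>J. INF a\<in>D. f a)"
proof (rule coverage[where R = R, OF mono])
  show "finite A" if "(\<A>, \<B>) \<in> R" "A \<in> \<A> \<union> \<B>" for \<A> \<B> A
    using R that unfolding PreFrm_type_def formally_directed_def by fast
  fix \<A> \<B> A and Y :: "'g set"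
  assume AB: "(\<A>, \<B>) \<in> R" and A: "A \<in> \<A>" and Y: "finite Y"
  have dir: "formally_directed \<B>" using R AB unfolding PreFrm_type_def by fast
  have "entails T (INF x\<in>joins A Y. f x) (SUP B\<in>\<B>. INF c\<in>Y. INF b\<in>B. f (sup b c))"
  proof (rule entails_directed_INF[OF Y])
    show "\<B> \<noteq> {}" using dir by (simp add: formally_directed_def directed_wrt_def)
    fix B B' assume B: "B \<in> \<B>" "B' \<in> \<B>"
    obtain B'' where B'': "B'' \<in> \<B>"
      "entails semilattice_relations (INF a\<in>B. gen a) (INF b\<in>B''. gen b)"
      "entails semilattice_relations (INF a\<in>B'. gen a) (INF b\<in>B''. gen b)"
      using dir B unfolding formally_directed_def directed_wrt_def by blast
    have "finite B" "finite B'" "finite B''"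
      using dir B B''(1) unfolding formally_directed_def by blast+
    then show "\<exists>B''\<in>\<B>. \<forall>c\<in>Y.
        entails T (INF b\<in>B. f (sup b c)) (INF b\<in>B''. f (sup b c)) \<and>
        entails T (INF b\<in>B'. f (sup b c)) (INF b\<in>B''. f (sup b c))"
      using B'' by (auto intro!: bexI[of _ B''] entails_semilattice_joins mono)
  next
    fix c assume c: "c \<in> Y"
    have "((\<lambda>A. (\<lambda>a. sup a c) ` A) ` \<A>, (\<lambda>B. (\<lambda>b. sup b c) ` B) ` \<B>) \<in> R"
      using R AB unfolding PreFrm_type_def by fast
    from rel[OF this]
    have "entails T (SUP A\<in>\<A>. INF a\<in>A. f (sup a c)) (SUP B\<in>\<B>. INF b\<in>B. f (sup b c))"
      by (simp add: image_image)
    moreover have "(INF x\<in>joins A Y. f x) \<le> (SUP A\<in>\<A>. INF a\<in>A. f (sup a c))"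
      unfolding INF_joins by (rule order_trans[OF INF_lower[OF c] SUP_upper[OF A]])
    ultimately show "entails T (INF x\<in>joins A Y. f x) (SUP B\<in>\<B>. INF b\<in>B. f (sup b c))"
      by (meson entails_le entails_trans)
  qed
  then show "entails T (INF x\<in>joins A Y. f x) (SUP B\<in>\<B>. INF x\<in>joins B Y. f x)"
    by (simp add: INF_joins)
qed (use assms in auto)

section \<open>The image of a semi-proper quotient\<close>

text \<open>Shows that the right-hand family in \<open>box_relations\<close> is a directed
  representation of the join it stands for.\<close>

lemma represents_joins:
  fixes \<eta> :: "'g::semilattice_sup \<Rightarrow> 'a::frame"
  assumes A: "represents \<eta> \<A> x" and B: "represents \<eta> \<B> y"
    and sup: "\<And>a b. \<eta> (sup a b) = sup (\<eta> a) (\<eta> b)"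
  shows "represents \<eta> {joins A B | A B. A \<in> \<A> \<and> B \<in> \<B>} (sup x y)"
proof -
  let ?m = "\<lambda>A. INF a\<in>A. \<eta> a"
  have fin: "\<And>A. A \<in> \<A> \<Longrightarrow> finite A" "\<And>B. B \<in> \<B> \<Longrightarrow> finite B"
    and dir: "directed_wrt (\<le>) (?m ` \<A>)" "directed_wrt (\<le>) (?m ` \<B>)"
    and eq: "x = Sup (?m ` \<A>)" "y = Sup (?m ` \<B>)"
    using A B by (auto simp: represents_def)
  have set_eq: "{joins A B | A B. A \<in> \<A> \<and> B \<in> \<B>} = (\<lambda>(A, B). joins A B) ` (\<A> \<times> \<B>)" by auto
  have im: "?m ` {joins A B | A B. A \<in> \<A> \<and> B \<in> \<B>} =
      (\<lambda>(A, B). sup (?m A) (?m B)) ` (\<A> \<times> \<B>)"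
    unfolding set_eq image_image
    by (rule image_cong) (auto simp: INF_joins_sup[of _ _ \<eta>] fin sup simp del: INF_image)
  show ?thesis
    unfolding represents_def im
    using fin directed_SUP_sup[OF dir] by (auto simp: eq)
qed

locale semi_proper_presentation =
  fixes R :: "('g::bounded_semilattice_sup_bot set set \<times> 'g set set) set"
    and \<eta> :: "'g \<Rightarrow> 'a::frame"
    and qu :: "'b::frame \<Rightarrow> 'a" and ql :: "'a \<Rightarrow> 'b"
  assumes pres: "presents (semilattice_relations \<union> relations_of R) \<eta>"
    and q: "semi_proper_quotient qu ql"
begin

abbreviation meet where "meet A \<equiv> INF a\<in>A. \<eta> a"

text \<open>The largest family representing \<open>x\<close>. It is monotone in \<open>x\<close> and
  closed under \<open>joins\<close>, hence directed already for \<open>refines\<close>.\<close>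

definition below :: "'a \<Rightarrow> 'g set set" where
  "below x = {A. finite A \<and> meet A \<le> x}"

lemma qu_hom: "frame_hom qu"
  and adjoint: "qu y \<le> x \<longleftrightarrow> y \<le> ql x"
  and qu_inj: "inj qu"
  and ql_directed: "directed_wrt (\<le>) D \<Longrightarrow> ql (Sup D) = Sup (ql ` D)"
  using q by (auto simp: semi_proper_quotient_def right_adjoint_def)

lemma ql_mono: "x \<le> y \<Longrightarrow> ql x \<le> ql y"
  using adjoint order_trans by blast

lemma qu_ql_le: "qu (ql x) \<le> x"
  by (simp add: adjoint)

lemma qu_ql_mono: "x \<le> y \<Longrightarrow> qu (ql x) \<le> qu (ql y)"
  by (rule frame_hom_mono[OF qu_hom ql_mono])

text \<open>The adjunction gives equality after applying \<open>qu\<close>, and \<open>qu\<close> is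
  injective.\<close>

lemma ql_qu [simp]: "ql (qu y) = y"
proof -
  have "qu (ql (qu y)) = qu y"
    by (rule antisym[OF qu_ql_le frame_hom_mono[OF qu_hom]]) (simp only: adjoint[symmetric] order_refl)
  then show ?thesis using qu_inj by (simp add: inj_eq)
qed

lemma ql_inf: "ql (inf x y) = inf (ql x) (ql y)"
proof (rule antisym)
  show "ql (inf x y) \<le> inf (ql x) (ql y)" by (simp add: ql_mono)
  have "qu (inf (ql x) (ql y)) = inf (qu (ql x)) (qu (ql y))"
    using qu_hom by (simp add: frame_hom_def)
  also have "\<dots> \<le> inf x y" by (intro inf_mono qu_ql_le)
  finally show "inf (ql x) (ql y) \<le> ql (inf x y)" by (simp only: adjoint)
qed

lemma ql_top: "ql top = top"
  by (rule top_le) (simp only: adjoint[symmetric] top_greatest)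

lemma ql_INF: "finite A \<Longrightarrow> ql (INF a\<in>A. f a) = (INF a\<in>A. ql (f a))"
  by (induction A rule: finite_induct) (simp_all add: ql_inf ql_top)

lemma ql_bot [simp]: "ql bot = bot"
  using ql_qu[of bot] unfolding frame_hom_bot[OF qu_hom] .

lemma entails_iff: "interpret_free \<eta> u \<le> interpret_free \<eta> v \<longleftrightarrow>
    entails (semilattice_relations \<union> relations_of R) u v"
  using pres by (simp add: presents_def)

lemma \<eta>_sup: "\<eta> (sup a b) = sup (\<eta> a) (\<eta> b)"
proof -
  have "equation (gen (sup a b)) (sup (gen a) (gen b)) \<subseteq> semilattice_relations \<union> relations_of R"
    by (auto simp: semilattice_relations_def)
  from entails_equation[OF this] show ?thesis
    unfolding entails_iff[symmetric]
    by (intro antisym) (simp_all add: frame_hom_sup[OF frame_hom_interpret_free])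
qed

lemma \<eta>_bot: "\<eta> bot = bot"
proof -
  have "equation (gen bot) bot \<subseteq> semilattice_relations \<union> relations_of R"
    by (auto simp: semilattice_relations_def)
  from entails_equation(1)[OF this] show ?thesis
    unfolding entails_iff[symmetric]
    by (simp add: frame_hom_bot[OF frame_hom_interpret_free] bot_unique)
qed

lemma \<eta>_mono: "s \<le> t \<Longrightarrow> \<eta> s \<le> \<eta> t"
  by (metis \<eta>_sup le_iff_sup)

lemma below_mono: "x \<le> y \<Longrightarrow> below x \<subseteq> below y"
  by (auto simp: below_def)

lemma joins_below:
  assumes "A \<in> below x" "B \<in> below x"
  shows "joins A B \<in> below x"
  using assms by (auto simp: below_def INF_joins_sup[of _ _ \<eta>] \<eta>_sup simp del: INF_image)

lemma bot_below: "{bot} \<in> below x"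
  by (simp add: below_def \<eta>_bot)

text \<open>Surjectivity of the interpretation writes \<open>x\<close> as a join of finite meets of
  generators, all of which occur in \<open>below x\<close>.\<close>

lemma represents_below: "represents \<eta> (below x) x"
proof -
  have "\<exists>C\<in>below x. meet A \<le> meet C \<and> meet B \<le> meet C"
    if "A \<in> below x" "B \<in> below x" for A B
    using that joins_below[OF that]
    by (intro bexI[of _ "joins A B"])
      (auto simp: below_def INF_joins_sup[of _ _ \<eta>] \<eta>_sup simp del: INF_image)
  then have "directed_wrt (\<le>) (meet ` below x)"
    using bot_below[of x] unfolding directed_wrt_def by auto
  moreover have "x \<le> (SUP A\<in>below x. meet A)"
  proof -
    obtain u where u: "x = interpret_free \<eta> u" using pres unfolding presents_def surj_def by blast
    have "A \<in> below x" if "A \<in> Rep_free_frame u" for A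
      using that unfolding u interpret_free_def below_def
      by (auto intro: finite_Rep_free_frame SUP_upper)
    then show ?thesis
      unfolding u interpret_free_def by (intro SUP_subset_mono) (auto simp: u interpret_free_def)
  qed
  then have "x = (SUP A\<in>below x. meet A)"
    by (intro antisym SUP_least) (auto simp: below_def)
  ultimately show ?thesis by (simp add: represents_def) (simp add: below_def)
qed

end

text \<open>\<open>T\<close> lies between the relations without and with
  \<open>order_relations\<close>, so that one argument covers both readings; \<open>T_mono\<close>
  records what is needed of the order on generators.\<close>

locale box_presentation = semi_proper_presentation R \<eta> qu ql
  for R :: "('g::bounded_semilattice_sup_bot set set \<times> 'g set set) set"
    and \<eta> :: "'g \<Rightarrow> 'a::frame"
    and qu :: "'b::frame \<Rightarrow> 'a" and ql :: "'a \<Rightarrow> 'b" +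
  fixes N :: "'g \<Rightarrow> 'g set set"
    and T :: "'g relations"
  assumes R: "PreFrm_type R"
    and N: "\<And>s. represents \<eta> (N s) (qu (ql (\<eta> s)))"
    and T: "relations_of R \<union> box_relations N \<subseteq> T"
      "T \<subseteq> relations_of R \<union> order_relations \<union> box_relations N"
    and T_mono: "\<And>s t. s \<le> t \<Longrightarrow> entails T (gen s) (gen t)"
begin

abbreviation box_meet where "box_meet A \<equiv> INF a\<in>A. gen (a::'g)"

text \<open>The preframe homomorphism extending \<open>gen\<close>, up to entailment.\<close>

definition box :: "'a \<Rightarrow> 'g free_frame" where
  "box x = (SUP A\<in>below x. box_meet A)"

text \<open>An inequality valid in \<open>OX\<close> is derivable from the presentation of
  \<open>OX\<close>; coverage for \<open>f = gen\<close> turns this into a derivation from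
  \<open>T\<close>.\<close>

lemma entails_box_meet:
  assumes "finite A" "J \<noteq> {}" "\<And>D. D \<in> J \<Longrightarrow> finite D"
    and "\<And>D D'. D \<in> J \<Longrightarrow> D' \<in> J \<Longrightarrow> \<exists>D''\<in>J. refines D D'' \<and> refines D' D''"
    and "meet A \<le> (SUP D\<in>J. meet D)"
  shows "entails T (box_meet A) (SUP D\<in>J. box_meet D)"
proof (rule PreFrm_type_coverage[OF R T_mono])
  show "entails T (SUP A\<in>\<A>. box_meet A) (SUP B\<in>\<B>. box_meet B)" if "(\<A>, \<B>) \<in> R" for \<A> \<B>
  proof (rule entails_relation)
    have "(join_of_meets \<A>, join_of_meets \<B>) \<in> relations_of R"
      using that unfolding relations_of_def by force
    then show "(SUP A\<in>\<A>. box_meet A, SUP B\<in>\<B>. box_meet B) \<in> T"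
      using T(1) by (auto simp: join_of_meets_def)
  qed
  show "entails (semilattice_relations \<union> relations_of R) (box_meet A) (join_of_meets J)"
    unfolding entails_iff[symmetric]
    using assms by (simp add: interpret_free_INF_gen interpret_free_join_of_meets)
qed (use assms in auto)

lemma entails_box_meet_mono:
  assumes "finite A" "finite B" "meet A \<le> meet B"
  shows "entails T (box_meet A) (box_meet B)"
  using entails_box_meet[of A "{B}"] assms by (auto simp: refines_def)

lemma box_mono: "x \<le> y \<Longrightarrow> box x \<le> box y"
  unfolding box_def by (intro SUP_subset_mono below_mono) auto

lemma box_meet_le: "finite A \<Longrightarrow> box_meet A \<le> box (meet A)"
  unfolding box_def by (rule SUP_upper) (simp add: below_def)

lemma entails_box_of_meet: "finite A \<Longrightarrow> entails T (box (meet A)) (box_meet A)"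
  unfolding box_def by (rule entails_SUP) (auto simp: below_def intro: entails_box_meet_mono)

lemma entails_box_\<eta>: "entails T (box (\<eta> g)) (gen g)"
  using entails_box_of_meet[of "{g}"] by simp

lemma box_inf: "inf (box x) (box y) \<le> box (inf x y)"
proof -
  have "inf (box_meet A) (box_meet B) \<le> box (inf x y)" if "A \<in> below x" "B \<in> below y" for A B
  proof -
    have "A \<union> B \<in> below (inf x y)"
      using that by (auto simp: below_def INF_union intro: le_infI1 le_infI2)
    then show ?thesis unfolding box_def INF_union[symmetric] by (rule SUP_upper)
  qed
  then show ?thesis
    unfolding box_def[of x] box_def[of y] SUP_inf_SUP_frame by (blast intro: SUP_least)
qed

lemma entails_box_INF:
  "finite A \<Longrightarrow> (\<And>a. a \<in> A \<Longrightarrow> entails T w (box (f a))) \<Longrightarrow> entails T w (box (INF a\<in>A. f a))"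
proof (induction A rule: finite_induct)
  case empty
  have "(top :: 'g free_frame) \<le> box top"
    using box_meet_le[of "{}"] by simp
  then show ?case by (auto intro: entails_le order_trans[OF top_greatest])
next
  case (insert a A)
  then have "entails T w (inf (box (f a)) (box (INF a\<in>A. f a)))" by (auto intro: entails_inf)
  then show ?case by (metis INF_insert box_inf entails_le entails_trans)
qed

text \<open>The union of the families \<open>below (f i)\<close> is directed for
  \<open>refines\<close>, as coverage requires: \<open>joins D D'\<close> lies in
  \<open>below (f k)\<close> for a common bound \<open>f k\<close>.\<close>

lemma entails_box_directed:
  assumes "directed_wrt (\<le>) (f ` I)"
  shows "entails T (box (SUP i\<in>I. f i)) (SUP i\<in>I. box (f i))"
  unfolding box_def[of "SUP i\<in>I. f i"]
proof (rule entails_SUP)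
  fix A assume A: "A \<in> below (SUP i\<in>I. f i)"
  let ?J = "\<Union>i\<in>I. below (f i)"
  obtain i0 where i0: "i0 \<in> I" using assms by (auto simp: directed_wrt_def)
  have "entails T (box_meet A) (SUP D\<in>?J. box_meet D)"
  proof (rule entails_box_meet)
    show "finite A" using A by (simp add: below_def)
    show "?J \<noteq> {}" using i0 bot_below by blast
    show "finite D" if "D \<in> ?J" for D using that by (auto simp: below_def)
    show "\<exists>D''\<in>?J. refines D D'' \<and> refines D' D''" if D: "D \<in> ?J" "D' \<in> ?J" for D D'
    proof -
      obtain i j where ij: "i \<in> I" "D \<in> below (f i)" "j \<in> I" "D' \<in> below (f j)" using D by blast
      obtain k where k: "k \<in> I" "f i \<le> f k" "f j \<le> f k"
        using assms ij unfolding directed_wrt_def by blast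
      have "joins D D' \<in> below (f k)"
        using ij k below_mono by (blast intro: joins_below)
      then show ?thesis using k(1) refines_joins1 refines_joins2 by blast
    qed
    have "f i = (SUP D\<in>below (f i). meet D)" for i
      using represents_below by (simp add: represents_def)
    then have "(SUP i\<in>I. f i) = (SUP D\<in>?J. meet D)"
      by (simp add: SUP_UNION)
    then show "meet A \<le> (SUP D\<in>?J. meet D)" using A by (simp add: below_def)
  qed
  then show "entails T (box_meet A) (SUP i\<in>I. box (f i))"
    by (simp add: box_def SUP_UNION)
qed

text \<open>An arbitrary representation is directed only in \<open>OX\<close>, not for
  \<open>refines\<close>, in general; passing through \<open>box\<close> handles it.\<close>

lemma entails_box_represents:
  assumes "represents \<eta> \<A> x"
  shows "entails T (box x) (join_of_meets \<A>)"
proof -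
  have dir: "directed_wrt (\<le>) (meet ` \<A>)" and x: "x = (SUP A\<in>\<A>. meet A)"
    and fin: "\<And>A. A \<in> \<A> \<Longrightarrow> finite A"
    using assms by (auto simp: represents_def)
  have "entails T (box x) (SUP A\<in>\<A>. box (meet A))"
    unfolding x by (rule entails_box_directed[OF dir])
  moreover have "entails T (SUP A\<in>\<A>. box (meet A)) (join_of_meets \<A>)"
    unfolding join_of_meets_def by (rule entails_SUP_mono) (blast intro: entails_box_of_meet fin)
  ultimately show ?thesis by (rule entails_trans)
qed

section \<open>The box relation, from generators to all elements\<close>

lemma represents_box_join:
  "represents \<eta> {joins A B | A B. A \<in> N s \<and> B \<in> N t} (sup (qu (ql (\<eta> s))) (qu (ql (\<eta> t))))"
  by (intro represents_joins N \<eta>_sup)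

lemma box_relation_equation:
  "equation (sup (gen s) (gen t)) (join_of_meets {joins A B | A B. A \<in> N s \<and> B \<in> N t}) \<subseteq> T"
  using T(1) unfolding box_relations_def by blast

lemma entails_box_sup_gen:
  "entails T (box (sup (qu (ql (\<eta> s))) (qu (ql (\<eta> t))))) (sup (gen s) (gen t))"
  by (rule entails_trans[OF entails_box_represents[OF represents_box_join]
        entails_equation(2)[OF box_relation_equation]])

text \<open>By distributivity the right side is a finite meet of elements
  \<open>sup (gen a) (gen b)\<close>, and each of these is reached by monotonicity from
  \<open>entails_box_sup_gen\<close>.\<close>

lemma entails_box_sup_meet:
  assumes "finite A" "finite B"
  shows "entails T (box (sup (qu (ql (meet A))) (qu (ql (meet B))))) (sup (box_meet A) (box_meet B))"
proof -
  have "sup (box_meet A) (box_meet B) = (INF b\<in>B. INF a\<in>A. sup (gen a) (gen b))"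
    unfolding sup_INF_frame[OF assms(2)]
    by (simp only: INF_sup_frame[OF assms(1)])
  moreover have "entails T (box (sup (qu (ql (meet A))) (qu (ql (meet B))))) (sup (gen a) (gen b))"
    if "a \<in> A" "b \<in> B" for a b
    by (rule entails_trans[OF entails_le[OF box_mono] entails_box_sup_gen])
      (use that in \<open>intro sup_mono qu_ql_mono INF_lower\<close>)
  ultimately show ?thesis using assms by (auto intro!: entails_INF)
qed

lemma qu_ql_directed:
  assumes "directed_wrt (\<le>) D"
  shows "qu (ql (Sup D)) = (SUP x\<in>D. qu (ql x))" "directed_wrt (\<le>) ((\<lambda>x. qu (ql x)) ` D)"
proof -
  show "qu (ql (Sup D)) = (SUP x\<in>D. qu (ql x))"
    by (simp add: ql_directed[OF assms] frame_hom_SUP[OF qu_hom])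
  show "directed_wrt (\<le>) ((\<lambda>x. qu (ql x)) ` D)"
    using assms unfolding directed_wrt_def by (simp, meson qu_ql_mono)
qed

text \<open>Semi-properness enters here: \<open>qu\<close> after \<open>ql\<close> preserves
  directed joins, so \<open>x\<close> and \<open>y\<close> can be replaced by the finite meets below
  them.\<close>

lemma entails_box_sup:
  "entails T (box (sup (qu (ql x)) (qu (ql y)))) (sup (box x) (box y))"
proof -
  let ?n = "\<lambda>A. qu (ql (meet A))"
  have dir: "directed_wrt (\<le>) (?n ` below z)" and eq: "qu (ql z) = (SUP A\<in>below z. ?n A)" for z
  proof -
    have z: "directed_wrt (\<le>) (meet ` below z)" "z = Sup (meet ` below z)"
      using represents_below[of z] by (simp_all add: represents_def)
    show "directed_wrt (\<le>) (?n ` below z)" using qu_ql_directed(2)[OF z(1)] by (simp add: image_image)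
    show "qu (ql z) = (SUP A\<in>below z. ?n A)"
      using qu_ql_directed(1)[OF z(1)] z(2) by (simp add: image_image)
  qed
  note sup_dir = directed_SUP_sup[OF dir dir]
  have "entails T (box (sup (qu (ql x)) (qu (ql y))))
      (SUP p\<in>below x \<times> below y. box (case p of (A, B) \<Rightarrow> sup (?n A) (?n B)))"
    unfolding eq[of x] eq[of y] sup_dir(2) by (rule entails_box_directed[OF sup_dir(1)])
  moreover have "entails T (box (sup (?n A) (?n B))) (sup (box x) (box y))"
    if "A \<in> below x" "B \<in> below y" for A B
  proof (rule entails_trans[OF entails_box_sup_meet])
    show "entails T (sup (box_meet A) (box_meet B)) (sup (box x) (box y))"
      using that by (intro entails_le sup_mono) (auto simp: box_def intro: SUP_upper)
  qed (use that in \<open>auto simp: below_def\<close>)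
  then have "entails T (SUP p\<in>below x \<times> below y. box (case p of (A, B) \<Rightarrow> sup (?n A) (?n B)))
      (sup (box x) (box y))"
    by (intro entails_SUP) auto
  ultimately show ?thesis by (rule entails_trans)
qed

text \<open>On elements \<open>qu y\<close> the composite \<open>qu\<close> after \<open>ql\<close>
  is the identity, so \<open>entails_box_sup\<close> gives binary joins. The relation on
  \<open>gen bot\<close> gives the empty join, and directed joins are already known.\<close>

lemma entails_box_qu_Sup: "entails T (box (qu (Sup Y))) (SUP y\<in>Y. box (qu y))"
proof -
  have fin: "entails T (box (qu (Sup Z))) (SUP y\<in>Z. box (qu y))" if "finite Z" for Z
    using that
  proof (induction Z rule: finite_induct)
    case empty
    have "equation (gen bot) bot \<subseteq> T" using T(1) by (auto simp: box_relations_def)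
    then have "entails T (gen bot) bot" by (rule entails_equation)
    with entails_box_\<eta>[of bot] have "entails T (box (\<eta> bot)) bot" by (rule entails_trans)
    then show ?case by (simp add: frame_hom_bot[OF qu_hom] \<eta>_bot)
  next
    case (insert z Z)
    have "entails T (box (qu (Sup (insert z Z)))) (sup (box (qu z)) (box (qu (Sup Z))))"
      using entails_box_sup[of "qu z" "qu (Sup Z)"] by (simp add: frame_hom_sup[OF qu_hom])
    moreover have "entails T (sup (box (qu z)) (box (qu (Sup Z)))) (SUP y\<in>insert z Z. box (qu y))"
      by (rule entails_sup[OF entails_le entails_trans[OF insert.IH entails_le]]) simp_all
    ultimately show ?case by (rule entails_trans)
  qed
  let ?F = "{Z. finite Z \<and> Z \<subseteq> Y}"
  have "directed_wrt (\<le>) ((\<lambda>Z. qu (Sup Z)) ` ?F)"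
    using Sup_eq_SUP_finite_subsets(2)[of Y] frame_hom_mono[OF qu_hom]
    unfolding directed_wrt_def by (simp, meson)
  then have "entails T (box (SUP Z\<in>?F. qu (Sup Z))) (SUP Z\<in>?F. box (qu (Sup Z)))"
    by (rule entails_box_directed)
  moreover have "qu (Sup Y) = (SUP Z\<in>?F. qu (Sup Z))"
    by (subst Sup_eq_SUP_finite_subsets(1)) (rule frame_hom_SUP[OF qu_hom])
  moreover have "entails T (SUP Z\<in>?F. box (qu (Sup Z))) (SUP y\<in>Y. box (qu y))"
    by (rule entails_SUP, rule entails_trans[OF fin]) (auto intro: entails_le SUP_subset_mono)
  ultimately show ?thesis by (metis entails_trans)
qed

text \<open>The case \<open>t = bot\<close> of the box relation, where the second summand
  \<open>qu (ql (\<eta> bot))\<close> vanishes.\<close>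

lemma entails_gen_box: "entails T (gen g) (box (qu (ql (\<eta> g))))"
proof -
  let ?\<A> = "{joins A B | A B. A \<in> N g \<and> B \<in> N bot}"
  have rep: "represents \<eta> ?\<A> (qu (ql (\<eta> g)))"
    using represents_box_join[of g bot] by (simp add: \<eta>_bot frame_hom_bot[OF qu_hom])
  have "entails T (gen g) (sup (gen g) (gen bot))" by (simp add: entails_le)
  also have "entails T \<dots> (join_of_meets ?\<A>)"
    by (rule entails_equation(1)[OF box_relation_equation])
  also have "entails T \<dots> (box (qu (ql (\<eta> g))))"
  proof -
    have "A \<in> below (qu (ql (\<eta> g)))" if "A \<in> ?\<A>" for A
      using rep that unfolding represents_def below_def by (metis (mono_tags, lifting) SUP_upper mem_Collect_eq)
    then show ?thesis
      unfolding join_of_meets_def box_def by (intro entails_le SUP_subset_mono) auto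
  qed
  finally show ?thesis .
qed

section \<open>The comparison map to \<open>OY\<close> and its inverse\<close>

abbreviation phi :: "'g free_frame \<Rightarrow> 'b" where
  "phi \<equiv> interpret_free (\<lambda>g. ql (\<eta> g))"

text \<open>\<open>ql\<close> preserves directed joins and finite meets, so the value depends only
  on the element represented.\<close>

lemma phi_represents:
  assumes "represents \<eta> \<A> x"
  shows "phi (join_of_meets \<A>) = ql x"
proof -
  have dir: "directed_wrt (\<le>) (meet ` \<A>)" and x: "x = (SUP A\<in>\<A>. meet A)"
    and fin: "\<forall>A\<in>\<A>. finite A"
    using assms by (auto simp: represents_def)
  have "ql x = (SUP A\<in>\<A>. ql (meet A))" unfolding x ql_directed[OF dir] by (simp add: image_image)
  also have "\<dots> = phi (join_of_meets \<A>)"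
    unfolding interpret_free_join_of_meets[OF fin] by (rule SUP_cong) (use fin in \<open>auto simp: ql_INF\<close>)
  finally show ?thesis ..
qed

lemma phi_sound:
  assumes "(u, v) \<in> T"
  shows "phi u \<le> phi v"
proof -
  consider \<A> \<B> where "(\<A>, \<B>) \<in> R" "u = join_of_meets \<A>" "v = join_of_meets \<B>"
    | s t where "u = gen s" "v = gen t" "s \<le> t"
    | "(u, v) \<in> equation (gen bot) bot"
    | s t where "(u, v) \<in> equation (sup (gen s) (gen t))
        (join_of_meets {joins A B | A B. A \<in> N s \<and> B \<in> N t})"
    using subsetD[OF T(2) assms]
    by (auto simp: relations_of_def order_relations_def box_relations_def)
  then show ?thesis
  proof cases
    case (1 \<A> \<B>)
    have dir: "formally_directed \<A>" "formally_directed \<B>"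
      using R 1(1) unfolding PreFrm_type_def by fast+
    \<comment> \<open>Formal directedness over the semilattice becomes directedness in
      \<open>OX\<close>, because \<open>\<eta>\<close> satisfies the semilattice relations. Only
      then can \<open>ql\<close> be moved inside the join.\<close>
    have rep: "represents \<eta> \<C> (interpret_free \<eta> (join_of_meets \<C>))"
      if C: "formally_directed \<C>" for \<C>
    proof -
      have fin: "\<forall>A\<in>\<C>. finite A" using C by (simp add: formally_directed_def)
      have "meet A \<le> meet B"
        if "entails semilattice_relations (box_meet A) (box_meet B)" "A \<in> \<C>" "B \<in> \<C>" for A B
      proof -
        have "interpret_free \<eta> (box_meet A) \<le> interpret_free \<eta> (box_meet B)"
          by (rule entails_frame_hom[OF that(1) frame_hom_interpret_free])
            (simp add: entails_iff entails_relation)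
        then show ?thesis using that fin by (simp add: interpret_free_INF_gen)
      qed
      then have "directed_wrt (\<le>) (meet ` \<C>)"
        using C unfolding formally_directed_def directed_wrt_def by simp blast
      then show ?thesis
        using fin by (simp add: represents_def interpret_free_join_of_meets)
    qed
    have "(u, v) \<in> relations_of R" using 1 unfolding relations_of_def by force
    then have "interpret_free \<eta> u \<le> interpret_free \<eta> v"
      by (simp add: entails_iff entails_relation)
    then show ?thesis
      using phi_represents[OF rep[OF dir(1)]] phi_represents[OF rep[OF dir(2)]]
      by (simp add: 1 ql_mono)
  next
    case (2 s t)
    then show ?thesis by (simp add: 2 ql_mono \<eta>_mono)
  next
    case 3
    have "phi bot = bot" by (rule frame_hom_bot[OF frame_hom_interpret_free])
    then show ?thesis using 3 by (auto simp: equation_def \<eta>_bot)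
  next
    case (4 s t)
    \<comment> \<open>Since \<open>qu\<close> preserves binary joins, the represented join is
      \<open>qu\<close> of \<open>sup (ql (\<eta> s)) (ql (\<eta> t))\<close>, which
      \<open>ql\<close> sends back.\<close>
    have "phi (join_of_meets {joins A B | A B. A \<in> N s \<and> B \<in> N t}) = phi (sup (gen s) (gen t))"
      unfolding phi_represents[OF represents_box_join]
      by (simp add: frame_hom_sup[OF frame_hom_interpret_free] frame_hom_sup[OF qu_hom, symmetric])
    then show ?thesis using 4 by (auto simp: equation_def)
  qed
qed

text \<open>For generators this is \<open>entails_gen_box\<close>; finite meets follow as
  \<open>box\<close> preserves them, and joins by monotonicity.\<close>

lemma entails_box_phi: "entails T u (box (qu (phi u)))"
proof -
  have "entails T (box_meet A) (box (qu (phi u)))" if A: "A \<in> Rep_free_frame u" for A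
  proof -
    have fin: "finite A" using A by (rule finite_Rep_free_frame)
    have "entails T (box_meet A) (box (INF a\<in>A. qu (ql (\<eta> a))))"
      by (rule entails_box_INF[OF fin]) (erule entails_INF_lower[of _ A T gen, OF _ entails_gen_box])
    moreover have "(INF a\<in>A. qu (ql (\<eta> a))) \<le> qu (phi u)"
      unfolding frame_hom_INF[OF fin qu_hom, symmetric] interpret_free_def
      by (intro frame_hom_mono[OF qu_hom] SUP_upper A)
    ultimately show ?thesis by (meson box_mono entails_le entails_trans)
  qed
  then have "entails T (join_of_meets (Rep_free_frame u)) (box (qu (phi u)))"
    unfolding join_of_meets_def by (rule entails_SUP)
  then show ?thesis by (simp add: join_of_meets_Rep)
qed

text \<open>Preservation of joins by \<open>box\<close> after \<open>qu\<close> reduces this to the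
  finite meets in \<open>u\<close>, where the counit of the adjunction gives elements below each
  \<open>\<eta> a\<close>.\<close>

lemma box_phi_entails: "entails T (box (qu (phi u))) u"
proof -
  have "entails T (box (qu (INF a\<in>A. ql (\<eta> a)))) (box_meet A)" if "finite A" for A
    using that
  proof (rule entails_INF)
    fix a assume "a \<in> A"
    then have "qu (INF a\<in>A. ql (\<eta> a)) \<le> \<eta> a" unfolding adjoint by (rule INF_lower)
    then show "entails T (box (qu (INF a\<in>A. ql (\<eta> a)))) (gen a)"
      by (meson box_mono entails_le entails_trans entails_box_\<eta>)
  qed
  then have "entails T (SUP A\<in>Rep_free_frame u. box (qu (INF a\<in>A. ql (\<eta> a))))
      (join_of_meets (Rep_free_frame u))"
    unfolding join_of_meets_def by (intro entails_SUP_mono) (blast intro: finite_Rep_free_frame)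
  moreover have "entails T (box (qu (phi u)))
      (SUP A\<in>Rep_free_frame u. box (qu (INF a\<in>A. ql (\<eta> a))))"
    unfolding interpret_free_def
    using entails_box_qu_Sup[of "(\<lambda>A. INF a\<in>A. ql (\<eta> a)) ` Rep_free_frame u"]
    by (simp add: image_image)
  ultimately show ?thesis by (metis entails_trans join_of_meets_Rep)
qed

theorem presents_quotient: "presents T (\<lambda>g. ql (\<eta> g))"
  unfolding presents_def
proof (intro conjI allI)
  \<comment> \<open>A preimage of \<open>y\<close> is any formal representation of
    \<open>qu y\<close>, since \<open>ql (qu y) = y\<close>.\<close>
  have "y = phi (join_of_meets (below (qu y)))" for y
    by (simp add: phi_represents[OF represents_below])
  then show "surj phi" by (rule surjI[OF sym])
  fix u v
  show "phi u \<le> phi v \<longleftrightarrow> entails T u v"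
  proof
    assume "phi u \<le> phi v"
    then have "box (qu (phi u)) \<le> box (qu (phi v))"
      by (rule box_mono[OF frame_hom_mono[OF qu_hom]])
    then show "entails T u v"
      by (rule entails_trans[OF entails_box_phi entails_trans[OF entails_le box_phi_entails]])
  next
    assume "entails T u v"
    then show "phi u \<le> phi v"
      using frame_hom_interpret_free phi_sound by (rule entails_frame_hom)
  qed
qed

end

text \<open>The two conjuncts read the specified representations differently: arbitrary ones, with
  the order of \<open>G\<close> imposed on the generators, and suitably chosen ones, for which that
  order is derivable.\<close>

theorem proposition3p4:
  fixes R :: "('g::bounded_semilattice_sup_bot set set \<times> 'g set set) set"
    and \<kappa> :: "'g free_frame set \<Rightarrow> 'a::frame"
    and \<eta> :: "'g \<Rightarrow> 'a"
    and qu :: "'b::frame \<Rightarrow> 'a" and ql :: "'a \<Rightarrow> 'b"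
  assumes "PreFrm_type R"
    and "presentation_iso (semilattice_relations \<union> relations_of R) \<kappa>"
    and "\<And>g. \<eta> g = \<kappa> (class_of (semilattice_relations \<union> relations_of R) (gen g))"
    and "semi_proper_quotient qu ql"
  shows "(\<forall>N. (\<forall>s. represents \<eta> (N s) (qu (ql (\<eta> s)))) \<longrightarrow>
            (\<exists>h :: 'g free_frame set \<Rightarrow> 'b.
               presentation_iso (relations_of R \<union> order_relations \<union> box_relations N) h)) \<and>
         (\<exists>N. (\<forall>s. represents \<eta> (N s) (qu (ql (\<eta> s)))) \<and>
            (\<exists>h :: 'g free_frame set \<Rightarrow> 'b.
               presentation_iso (relations_of R \<union> box_relations N) h))"
proof -
  have \<eta>: "\<eta> = (\<lambda>g. \<kappa> (class_of (semilattice_relations \<union> relations_of R) (gen g)))"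
    using assms(3) by blast
  have pres: "presents (semilattice_relations \<union> relations_of R) \<eta>"
    unfolding \<eta> by (rule presentation_iso_imp_presents[OF assms(2)])
  have all: "\<exists>h :: 'g free_frame set \<Rightarrow> 'b.
      presentation_iso (relations_of R \<union> order_relations \<union> box_relations N) h"
    if N: "\<forall>s. represents \<eta> (N s) (qu (ql (\<eta> s)))" for N
  proof -
    interpret box_presentation R \<eta> qu ql N
      "relations_of R \<union> order_relations \<union> box_relations N"
    proof
      show "entails (relations_of R \<union> order_relations \<union> box_relations N) (gen s) (gen t)"
        if "s \<le> t" for s t
        by (rule entails_relation) (use that in \<open>auto simp: order_relations_def\<close>)
    qed (use assms(1,4) pres N in auto)
    show ?thesis by (rule presents_imp_presentation_iso[OF presents_quotient])
  qed
  interpret semi_proper_presentation R \<eta> qu ql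
    using pres assms(4) by unfold_locales
  \<comment> \<open>For the largest representations, which are monotone in \<open>s\<close>, the relations with
    \<open>t = 0\<close> entail the order relations.\<close>
  define N where "N s = below (qu (ql (\<eta> s)))" for s
  let ?T = "relations_of R \<union> box_relations N"
  let ?J = "\<lambda>s. join_of_meets {joins A B | A B. A \<in> N s \<and> B \<in> N bot}"
  have N: "represents \<eta> (N s) (qu (ql (\<eta> s)))" for s
    unfolding N_def by (rule represents_below)
  have "entails ?T (gen s) (gen t)" if "s \<le> t" for s t
  proof -
    have eq: "equation (sup (gen s) (gen bot)) (?J s) \<subseteq> ?T" for s
      unfolding box_relations_def by blast
    have "equation (gen bot) bot \<subseteq> ?T" unfolding box_relations_def by blast
    then have bot: "entails ?T (gen bot) bot" by (rule entails_equation)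
    have "entails ?T (gen s) (sup (gen s) (gen bot))" by (simp add: entails_le)
    also have "entails ?T \<dots> (?J s)" by (rule entails_equation(1)[OF eq])
    also have "entails ?T \<dots> (?J t)"
    proof -
      have "N s \<subseteq> N t" unfolding N_def by (intro below_mono qu_ql_mono \<eta>_mono that)
      then show ?thesis unfolding join_of_meets_def by (intro entails_le SUP_subset_mono) auto
    qed
    also have "entails ?T \<dots> (sup (gen t) (gen bot))" by (rule entails_equation(2)[OF eq])
    also have "entails ?T \<dots> (gen t)"
      by (rule entails_sup[OF entails_le entails_trans[OF bot entails_le]]) simp_all
    finally show ?thesis .
  qed
  then interpret box_presentation R \<eta> qu ql N ?T
    by unfold_locales (use assms(1) N in auto)
  have "\<exists>h :: 'g free_frame set \<Rightarrow> 'b. presentation_iso ?T h"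
    by (rule presents_imp_presentation_iso[OF presents_quotient])
  with all N show ?thesis by blast
qed

end
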